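(* Let $T>0$, $\beta\in(\frac12,1]$, $\alpha\in(\frac12,\beta)$, let $\mathcal V,\mathcal W,\mathcal X$ be Banach spaces, $g\in C^\beta([0,T],\mathcal V)$, $w\in C^\alpha([0,T],\mathcal W)$, and let $\sigma\colon\mathbb R\times\mathcal W\times\mathcal X\to\mathcal L(\mathcal V,\mathcal X)$ be an $\alpha$-nice function (see context). Let $x$ be the unique solution of the Young differential equation $dx_t=\sigma(t,w_t,x_t)\,dg_t$ on $[0,T]$ with $x_0=a\in\mathcal X$. For a discretization $\pi=\{t_0,\dots,t_n\}$ with $0=t_0<\dots<t_n=T$ let $|\pi|=\max_k|t_{k+1}-t_k|$, let $$x^\pi_0=a,\qquad x^\pi_{k+1}=x^\pi_k+\sigma(t_k,w_{t_k},x^\pi_k)(g_{t_{k+1}}-g_{t_k})$$ be the Euler discretization, and let $$\bar x^\pi_t=x^\pi_k+\tfrac{t-t_k}{t_{k+1}-t_k}(x^\pi_{k+1}-x^\pi_k)\ \text{ for } t\in[t_k,t_{k+1}),\qquad\bar x^\pi_T=x^\pi_n.$$ Then for any $\alpha'\in(0,\alpha)$, $$\lim_{|\pi|\to0}\|\bar x^\pi-x\|_{\alpha'}=0.$$ Specifically, for any $\alpha\in(\frac12,\beta)$ such that $\sigma$ is $\alpha$-nice and any $R>0$ there exist $C^{R,\alpha}_{\rm Euler}>0$ and $\tau=\tau(R,\alpha)>0$ such that for all $\alpha'\in(0,\alpha)$, all initial conditions $a$ with $|a|\le R$, all drivers $g\in C^\beta([0,T],\mathcal V)$ with $[g]_\beta\le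 R$, all parameters $w\in C^\alpha([0,T],\mathcal W)$ with $\|w\|_\alpha\le R$, and all discretizations $\pi$ with $|\pi|\le\tau$, $$\|\bar x^\pi-x\|_{\alpha'}\le C^{R,\alpha}_{\rm Euler}\,|\pi|^{(1-\frac{\alpha'}{\alpha})(\alpha+\beta-1)}.$$
   Context: **Norms.** $|\cdot|$ denotes norms of vectors in Banach spaces (operator norm on $\mathcal L(\cdot,\cdot)$, the bounded linear operators). For a Banach-space-valued $f$ on $[0,T]$ and $\alpha\in(0,1]$: $[f]_\alpha=\sup_{s\ne t}\frac{|f_t-f_s|}{|t-s|^\alpha}$, $\|f\|_\alpha=\sup_s|f_s|+[f]_\alpha$. $C^\alpha([0,T],\mathcal E)$ is the space of $f\colon[0,T]\to\mathcal E$ with $\|f\|_\alpha<\infty$. **$\alpha$-nice function.** $\sigma\colon\mathbb R\times\mathcal W\times\mathcal X\to\mathcal L(\mathcal V,\mathcal X)$ is $\alpha$-nice if: (a) $\|\sigma\|_\infty<\infty$; (b) $\sigma$ is Fréchet differentiable in $x$, and there is a continuous $c\colon\mathbb R^3\to[0,\infty)$ such that both $F=\sigma$ and $F=D_x\sigma$ satisfy $|F(t,w,x)-F(t,\tilde w,\tilde x)|\le c(t,|w|,|\tilde w|)\bigl(|x-\tilde x|+(1+|x|+|\tilde x|)|w-\tilde w|\bigr)$; (c) there is a continuous $\mathsf c\colon\mathbb R\to[0,\infty)$ such that both $F=\sigma$ and $F=D_x\sigma$ satisfy $|F(t,w,x)-F(s,w,x)|\le\mathsf c(|w|)(1+|x|)|t-s|^\alpha$.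 **Solution.** $x\in C^\alpha([0,T],\mathcal X)$ solves the equation if $x_t=a+\int_0^t\sigma(s,w_s,x_s)\,dg_s$ for all $t\in[0,T]$, with the Young integral $\int_0^t\sigma(s,w_s,x_s)\,dg_s=\lim_{|\pi|\to0}\sum_{[u,v]\in\pi}\sigma(u,w_u,x_u)(g_v-g_u)$ over partitions $\pi$ of $[0,t]$ with mesh $|\pi|\to0$. Under the stated hypotheses a unique solution in $C^\alpha([0,T],\mathcal X)$ exists. The constants $C^{R,\alpha}_{\rm Euler}$ and $\tau$ may also depend on $\sigma,\beta,T$. *)

theory Defs
  imports "HOL-Analysis.Analysis"
begin

section \<open>Hoelder norms on [0,T]\<close>

text \<open>
  The norms take values in the extended nonnegative reals, so a supremum over an
  unbounded set is infinity. Only the values of a function on [0,T] matter.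
\<close>

definition holder_seminorm :: "real \<Rightarrow> real \<Rightarrow> (real \<Rightarrow> 'a::real_normed_vector) \<Rightarrow> ennreal" where
  "holder_seminorm T \<alpha> f =
     (SUP (s, t) \<in> {(s, t). s \<in> {0..T} \<and> t \<in> {0..T} \<and> s \<noteq> t}.
        ennreal (norm (f t - f s) / \<bar>t - s\<bar> powr \<alpha>))"

definition holder_norm :: "real \<Rightarrow> real \<Rightarrow> (real \<Rightarrow> 'a::real_normed_vector) \<Rightarrow> ennreal" where
  "holder_norm T \<alpha> f = (SUP s \<in> {0..T}. ennreal (norm (f s))) + holder_seminorm T \<alpha> f"

definition holder_space :: "real \<Rightarrow> real \<Rightarrow> (real \<Rightarrow> 'a::real_normed_vector) set" where
  "holder_space T \<alpha> = {f. holder_norm T \<alpha> f < \<infinity>}"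

section \<open>Nice functions\<close>

definition locally_lipschitz_growth ::
  "(real \<times> real \<times> real \<Rightarrow> real) \<Rightarrow>
   (real \<Rightarrow> 'w::real_normed_vector \<Rightarrow> 'x::real_normed_vector \<Rightarrow> 'e::real_normed_vector) \<Rightarrow> bool" where
  "locally_lipschitz_growth c F \<longleftrightarrow>
     (\<forall>t w w' x x'. norm (F t w x - F t w' x')
        \<le> c (t, norm w, norm w') * (norm (x - x') + (1 + norm x + norm x') * norm (w - w')))"

definition time_holder_growth ::
  "real \<Rightarrow> (real \<Rightarrow> real) \<Rightarrow>
   (real \<Rightarrow> 'w::real_normed_vector \<Rightarrow> 'x::real_normed_vector \<Rightarrow> 'e::real_normed_vector) \<Rightarrow> bool" where
  "time_holder_growth \<alpha> c F \<longleftrightarrow>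
     (\<forall>s t w x. norm (F t w x - F s w x) \<le> c (norm w) * (1 + norm x) * \<bar>t - s\<bar> powr \<alpha>)"

text \<open>\<open>D\<close> is the Frechet derivative of \<open>\<sigma>\<close> in \<open>x\<close>; it is uniquely determined by \<open>\<sigma>\<close>.\<close>

definition nice_function ::
  "real \<Rightarrow> (real \<Rightarrow> 'w::banach \<Rightarrow> 'x::banach \<Rightarrow> 'v::banach \<Rightarrow>\<^sub>L 'x) \<Rightarrow> bool" where
  "nice_function \<alpha> \<sigma> \<longleftrightarrow>
     (\<exists>M. \<forall>t w x. norm (\<sigma> t w x) \<le> M) \<and>
     (\<exists>D :: real \<Rightarrow> 'w \<Rightarrow> 'x \<Rightarrow> 'x \<Rightarrow>\<^sub>L ('v \<Rightarrow>\<^sub>L 'x).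
        (\<forall>t w x. (\<sigma> t w has_derivative blinfun_apply (D t w x)) (at x)) \<and>
        (\<exists>c. continuous_on UNIV c \<and> (\<forall>z. 0 \<le> c z) \<and>
             locally_lipschitz_growth c \<sigma> \<and> locally_lipschitz_growth c D) \<and>
        (\<exists>c. continuous_on UNIV c \<and> (\<forall>r. 0 \<le> c r) \<and>
             time_holder_growth \<alpha> c \<sigma> \<and> time_holder_growth \<alpha> c D))"

section \<open>Partitions and the Young integral\<close>

text \<open>
  A partition of [a,b] is the strictly increasing list of its points. The only
  partition of [a,a] is the list [a], whose mesh is 0.
\<close>

definition is_partition :: "real \<Rightarrow> real \<Rightarrow> real list \<Rightarrow> bool" where
  "is_partition a b \<pi> \<longleftrightarrow> \<pi> \<noteq> [] \<and> hd \<pi> = a \<and> last \<pi> = b \<and> sorted_wrt (<) \<pi>"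

definition mesh :: "real list \<Rightarrow> real" where
  "mesh \<pi> = Max (insert 0 ((\<lambda>k. \<bar>\<pi> ! Suc k - \<pi> ! k\<bar>) ` {..<length \<pi> - 1}))"

definition mesh_to_zero :: "real \<Rightarrow> real \<Rightarrow> real list filter" where
  "mesh_to_zero a b = inf (filtercomap mesh (nhds 0)) (principal {\<pi>. is_partition a b \<pi>})"

definition young_sum ::
  "(real \<Rightarrow> 'v::banach \<Rightarrow>\<^sub>L 'x::banach) \<Rightarrow> (real \<Rightarrow> 'v) \<Rightarrow> real list \<Rightarrow> 'x" where
  "young_sum f g \<pi> =
     (\<Sum>k<length \<pi> - 1. blinfun_apply (f (\<pi> ! k)) (g (\<pi> ! Suc k) - g (\<pi> ! k)))"

definition has_young_integral ::
  "(real \<Rightarrow> 'v::banach \<Rightarrow>\<^sub>L 'x::banach) \<Rightarrow> (real \<Rightarrow> 'v) \<Rightarrow> real \<Rightarrow> real \<Rightarrow> 'x \<Rightarrow> bool" where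
  "has_young_integral f g a b I \<longleftrightarrow> (young_sum f g \<longlongrightarrow> I) (mesh_to_zero a b)"

definition young_solution ::
  "real \<Rightarrow> real \<Rightarrow> (real \<Rightarrow> 'w::banach \<Rightarrow> 'x::banach \<Rightarrow> 'v::banach \<Rightarrow>\<^sub>L 'x) \<Rightarrow>
   (real \<Rightarrow> 'w) \<Rightarrow> (real \<Rightarrow> 'v) \<Rightarrow> 'x \<Rightarrow> (real \<Rightarrow> 'x) \<Rightarrow> bool" where
  "young_solution T \<alpha> \<sigma> w g a x \<longleftrightarrow>
     x \<in> holder_space T \<alpha> \<and>
     (\<forall>t\<in>{0..T}. \<exists>I. has_young_integral (\<lambda>s. \<sigma> s (w s) (x s)) g 0 t I \<and> x t = a + I)"

section \<open>Euler scheme\<close>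

primrec euler ::
  "(real \<Rightarrow> 'w::banach \<Rightarrow> 'x::banach \<Rightarrow> 'v::banach \<Rightarrow>\<^sub>L 'x) \<Rightarrow>
   (real \<Rightarrow> 'w) \<Rightarrow> (real \<Rightarrow> 'v) \<Rightarrow> 'x \<Rightarrow> real list \<Rightarrow> nat \<Rightarrow> 'x" where
  "euler \<sigma> w g a \<pi> 0 = a"
| "euler \<sigma> w g a \<pi> (Suc k) = euler \<sigma> w g a \<pi> k +
     blinfun_apply (\<sigma> (\<pi> ! k) (w (\<pi> ! k)) (euler \<sigma> w g a \<pi> k)) (g (\<pi> ! Suc k) - g (\<pi> ! k))"

text \<open>For a partition of [0,T], the values outside [0,T] are irrelevant.\<close>

definition euler_interp ::
  "(real \<Rightarrow> 'w::banach \<Rightarrow> 'x::banach \<Rightarrow> 'v::banach \<Rightarrow>\<^sub>L 'x) \<Rightarrow>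
   (real \<Rightarrow> 'w) \<Rightarrow> (real \<Rightarrow> 'v) \<Rightarrow> 'x \<Rightarrow> real list \<Rightarrow> real \<Rightarrow> 'x" where
  "euler_interp \<sigma> w g a \<pi> t =
     (if t = last \<pi> then euler \<sigma> w g a \<pi> (length \<pi> - 1)
      else let k = (THE k. Suc k < length \<pi> \<and> t \<in> {\<pi> ! k..<\<pi> ! Suc k})
           in euler \<sigma> w g a \<pi> k +
              ((t - \<pi> ! k) / (\<pi> ! Suc k - \<pi> ! k)) *\<^sub>R
                (euler \<sigma> w g a \<pi> (Suc k) - euler \<sigma> w g a \<pi> k))"

end

theory Submission
  imports Defs
begin

text \<open>
  The convergence of the Euler scheme is proved on finite grids, where the exact solution is itself
  an Euler scheme with small one-step errors.

  Young's inequality for Riemann sums holds on every finite grid with the same constant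
  (\<open>discrete_young_loeve\<close>). It implies a Gronwall lemma for recursions
  \<open>y (k+1) = y k + S k (g (k+1) - g k) + r k\<close> in which the coefficients \<open>S\<close> grow at most linearly in
  \<open>y\<close> and inherit its Hoelder regularity, and the remainders satisfy \<open>norm (r k) \<le> \<epsilon> (t (k+1) - t k)\<close>: the \<open>\<alpha>\<close>-Hoelder constant
  of \<open>y\<close> is bounded by a multiple of \<open>b + \<epsilon> + norm (y 0)\<close>, where \<open>b\<close> is the inhomogeneous part
  of the growth (\<open>young_recursion_holder\<close>).

  With \<open>b = 1\<close> and \<open>\<epsilon> = 1\<close> the lemma bounds the Euler scheme, and also the exact solution, which on
  a fine enough grid is a perturbed Euler scheme (\<open>solution_increment\<close>). These bounds are uniform
  over the data, and so is therefore the one-step error \<open>Q d powr (\<alpha> + \<beta>)\<close> of the solution on a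
  cell of length \<open>d\<close>. The difference of solution and scheme solves a recursion with \<open>b = 0\<close> and
  zero initial value, because the coefficients are differentiable with a regular derivative
  (\<open>coefficient_difference_increment\<close>). Its remainder is the one-step error, so that
  \<open>\<epsilon> = Q mesh powr (\<alpha> + \<beta> - 1)\<close>, and the lemma shows that the error is of order
  \<open>mesh powr (\<alpha> + \<beta> - 1)\<close> on the grid (\<open>euler_grid_error\<close>), hence in the sup norm after linear
  interpolation.

  Both the interpolated scheme and the solution are bounded in the \<open>\<alpha>\<close>-Hoelder seminorm.
  Interpolating between this bound and the sup estimate gives the rate in the \<open>\<alpha>'\<close>-Hoelder norm
  (\<open>interpolated_euler_error\<close>). The qualitative statement follows by choosing a radius \<open>R\<close> that
  dominates the given data.
\<close>

section \<open>Young sums on a finite grid\<close>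

text \<open>
  The constant \<open>\<kappa>\<close> of the discrete Young estimate. It is the fixed point of the recursion
  \<open>\<kappa> = 2 \<kappa> (1/2) powr \<theta> + 2\<close> produced by bisecting an interval, and it is
  positive for \<open>\<theta> > 1\<close>.
\<close>

definition young_const :: "real \<Rightarrow> real" where
  "young_const \<theta> = 2 / (1 - 2 powr (1 - \<theta>))"

lemma young_const_pos: "1 < \<theta> \<Longrightarrow> 0 < young_const \<theta>"
  using powr_less_mono[of "1 - \<theta>" 0 2] by (simp add: young_const_def)

lemma young_const_eq:
  assumes "1 < \<theta>"
  shows "2 * young_const \<theta> * (1 / 2) powr \<theta> + 2 = young_const \<theta>"
proof -
  have "2 powr (1 - \<theta>) < 1"
    using powr_less_mono[of "1 - \<theta>" 0 2] assms by simp
  moreover have "2 * (1 / 2) powr \<theta> = 2 powr (1 - \<theta>)"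
    by (simp add: powr_diff powr_divide)
  ultimately have "young_const \<theta> * (1 - 2 * (1 / 2) powr \<theta>) = 2"
    unfolding young_const_def by (metis less_irrefl nonzero_eq_divide_eq right_minus_eq)
  then show ?thesis
    by (simp add: algebra_simps)
qed

text \<open>
  Young's inequality for Riemann sums, with a constant independent of the grid. The grid is cut at the
  cell that contains the midpoint of the interval, which leaves two pieces of at most half the length.
  Regrouping the sum costs two products of an increment of \<open>S\<close> and an increment of \<open>g\<close>, each at
  most \<open>P R d powr (\<alpha> + \<beta>)\<close> with \<open>d\<close> the length of the interval; the two pieces together
  contribute \<open>2 (1/2) powr (\<alpha> + \<beta>) < 1\<close> times the bound for the whole, so the induction closes.
\<close>

lemma discrete_young_loeve:
  fixes S :: "nat \<Rightarrow> 'v::real_normed_vector \<Rightarrow>\<^sub>L 'x::real_normed_vector"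
    and g :: "nat \<Rightarrow> 'v" and t :: "nat \<Rightarrow> real"
  assumes exps: "0 < \<alpha>" "0 < \<beta>" "1 < \<alpha> + \<beta>" and "0 \<le> P" "0 \<le> R"
    and "i \<le> j"
    and "\<And>k l. i \<le> k \<Longrightarrow> k < l \<Longrightarrow> l \<le> j \<Longrightarrow> t k < t l"
    and "\<And>k l. i \<le> k \<Longrightarrow> k \<le> l \<Longrightarrow> l \<le> j \<Longrightarrow> norm (S l - S k) \<le> P * (t l - t k) powr \<alpha>"
    and "\<And>k l. i \<le> k \<Longrightarrow> k \<le> l \<Longrightarrow> l \<le> j \<Longrightarrow> norm (g l - g k) \<le> R * (t l - t k) powr \<beta>"
  shows "norm ((\<Sum>k=i..<j. S k (g (Suc k) - g k)) - S i (g j - g i))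
           \<le> young_const (\<alpha> + \<beta>) * P * R * (t j - t i) powr (\<alpha> + \<beta>)"
  using assms(6-9)
proof (induction "j - i" arbitrary: i j rule: less_induct)
  case less
  note mono = less.prems(2) and S = less.prems(3) and g = less.prems(4)
  let ?\<kappa> = "young_const (\<alpha> + \<beta>)"
  let ?E = "\<lambda>i j. (\<Sum>k=i..<j. S k (g (Suc k) - g k)) - S i (g j - g i)"
  have \<kappa>: "0 < ?\<kappa>" using young_const_pos exps by simp
  show ?case
  proof (cases "i = j")
    case True
    then show ?thesis by simp
  next
    case False
    then have "i < j" using less.prems(1) by simp
    define d where "d = t j - t i"
    have "0 < d" using mono[of i j] \<open>i < j\<close> by (simp add: d_def)
    \<comment> \<open>The cell from \<open>m\<close> to \<open>Suc m\<close> straddles the midpoint.\<close>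
    define m where "m = Max {k. i \<le> k \<and> k \<le> j \<and> t k - t i \<le> d / 2}"
    have fin: "finite {k. i \<le> k \<and> k \<le> j \<and> t k - t i \<le> d / 2}"
      by (rule finite_subset[of _ "{..j}"]) auto
    have "i \<in> {k. i \<le> k \<and> k \<le> j \<and> t k - t i \<le> d / 2}"
      using \<open>i < j\<close> \<open>0 < d\<close> by simp
    then have m: "i \<le> m" "m \<le> j" "t m - t i \<le> d / 2"
      using Max_in[OF fin] unfolding m_def[symmetric] by blast+
    have "m \<noteq> j" using m(3) \<open>0 < d\<close> by (auto simp: d_def)
    then have "m < j" using m(2) by simp
    have half: "t j - t (Suc m) \<le> d / 2"
    proof (rule ccontr)
      assume "\<not> ?thesis"
      then have "Suc m \<in> {k. i \<le> k \<and> k \<le> j \<and> t k - t i \<le> d / 2}"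
        using m(1) \<open>m < j\<close> by (simp add: d_def)
      then have "Suc m \<le> m" using Max_ge[OF fin] by (simp add: m_def)
      then show False by simp
    qed
    have le: "t k \<le> t l" if "i \<le> k" "k \<le> l" "l \<le> j" for k l
      using mono[of k l] that by (cases "k = l") auto
    have half_powr: "x powr (\<alpha> + \<beta>) \<le> (1 / 2) powr (\<alpha> + \<beta>) * d powr (\<alpha> + \<beta>)"
      if "0 \<le> x" "x \<le> d / 2" for x
    proof -
      have "x powr (\<alpha> + \<beta>) \<le> (1 / 2 * d) powr (\<alpha> + \<beta>)"
        using that exps by (intro powr_mono2) auto
      then show ?thesis using \<open>0 < d\<close> powr_mult[of "1 / 2" d "\<alpha> + \<beta>"] by simp
    qed
    have left: "norm (?E i m) \<le> ?\<kappa> * P * R * ((1 / 2) powr (\<alpha> + \<beta>) * d powr (\<alpha> + \<beta>))"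
    proof -
      have "norm (?E i m) \<le> ?\<kappa> * P * R * (t m - t i) powr (\<alpha> + \<beta>)"
        using m \<open>m < j\<close> by (intro less.hyps mono S g) auto
      also have "\<dots> \<le> ?\<kappa> * P * R * ((1 / 2) powr (\<alpha> + \<beta>) * d powr (\<alpha> + \<beta>))"
        using m le[of i m] \<kappa> assms(4,5) by (intro mult_left_mono half_powr) auto
      finally show ?thesis .
    qed
    have right: "norm (?E (Suc m) j) \<le> ?\<kappa> * P * R * ((1 / 2) powr (\<alpha> + \<beta>) * d powr (\<alpha> + \<beta>))"
    proof -
      have "norm (?E (Suc m) j) \<le> ?\<kappa> * P * R * (t j - t (Suc m)) powr (\<alpha> + \<beta>)"
        using m \<open>m < j\<close> by (intro less.hyps mono S g) auto
      also have "\<dots> \<le> ?\<kappa> * P * R * ((1 / 2) powr (\<alpha> + \<beta>) * d powr (\<alpha> + \<beta>))"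
        using m le[of "Suc m" j] \<open>m < j\<close> half \<kappa> assms(4,5)
        by (intro mult_left_mono half_powr) auto
      finally show ?thesis .
    qed
    have corr: "norm ((S p - S i) (g r - g q)) \<le> P * R * d powr (\<alpha> + \<beta>)"
      if "i \<le> p" "p \<le> j" "i \<le> q" "q \<le> r" "r \<le> j" for p q r
    proof -
      have "norm (S p - S i) \<le> P * (t p - t i) powr \<alpha>"
        using that by (intro S) auto
      also have "\<dots> \<le> P * d powr \<alpha>"
        unfolding d_def using that le[of i p] le[of p j] exps assms(4)
        by (intro mult_left_mono powr_mono2) auto
      finally have 1: "norm (S p - S i) \<le> P * d powr \<alpha>" .
      have "norm (g r - g q) \<le> R * (t r - t q) powr \<beta>"
        using that by (intro g) auto
      also have "\<dots> \<le> R * d powr \<beta>"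
        unfolding d_def using that le[of i q] le[of q r] le[of r j] exps assms(5)
        by (intro mult_left_mono powr_mono2) auto
      finally have 2: "norm (g r - g q) \<le> R * d powr \<beta>" .
      have "norm ((S p - S i) (g r - g q)) \<le> norm (S p - S i) * norm (g r - g q)"
        by (rule norm_blinfun)
      also have "\<dots> \<le> (P * d powr \<alpha>) * (R * d powr \<beta>)"
        using 1 2 assms(4) by (intro mult_mono) auto
      finally show ?thesis by (simp add: powr_add mult_ac)
    qed
    have split: "(\<Sum>k=i..<j. S k (g (Suc k) - g k)) =
        (\<Sum>k=i..<m. S k (g (Suc k) - g k)) + S m (g (Suc m) - g m)
        + (\<Sum>k=Suc m..<j. S k (g (Suc k) - g k))"
      using m(1) \<open>m < j\<close>
      by (subst sum.atLeastLessThan_concat[of i m j, symmetric])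
         (auto simp: sum.atLeast_Suc_lessThan add.assoc)
    have eq: "?E i j = ?E i m + ?E (Suc m) j
        + ((S m - S i) (g (Suc m) - g m) + (S (Suc m) - S i) (g j - g (Suc m)))"
      unfolding split by (simp add: blinfun.diff_left blinfun.diff_right algebra_simps)
    have "norm (?E i j) \<le> norm (?E i m) + norm (?E (Suc m) j)
        + (norm ((S m - S i) (g (Suc m) - g m)) + norm ((S (Suc m) - S i) (g j - g (Suc m))))"
      unfolding eq by (intro norm_triangle_le add_mono order_refl)
    also have "\<dots> \<le> ?\<kappa> * P * R * ((1 / 2) powr (\<alpha> + \<beta>) * d powr (\<alpha> + \<beta>))
        + ?\<kappa> * P * R * ((1 / 2) powr (\<alpha> + \<beta>) * d powr (\<alpha> + \<beta>))
        + (P * R * d powr (\<alpha> + \<beta>) + P * R * d powr (\<alpha> + \<beta>))"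
      using m \<open>m < j\<close> by (intro add_mono left right corr) auto
    also have "\<dots> = (2 * ?\<kappa> * (1 / 2) powr (\<alpha> + \<beta>) + 2) * P * R * d powr (\<alpha> + \<beta>)"
      by (simp add: algebra_simps)
    also have "\<dots> = ?\<kappa> * P * R * d powr (\<alpha> + \<beta>)"
      using exps by (simp only: young_const_eq)
    finally show ?thesis by (simp add: d_def)
  qed
qed

section \<open>Young recursions and their Hoelder bounds\<close>

text \<open>
  A recursion \<open>y (k+1) = y k + S k (g (k+1) - g k) + r k\<close> whose coefficients are controlled by
  \<open>y\<close> itself. The offset \<open>b\<close> decides which of two equations is modelled: \<open>b = 1\<close> gives affine
  growth, as for a solution or an Euler scheme, and \<open>b = 0\<close> gives the linearised equation satisfied
  by the difference of two of them. The remainder is measured as a Lipschitz function of time, so that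
  remainders of order \<open>d powr (\<alpha> + \<beta>)\<close> enter with the small factor
  \<open>\<epsilon> = mesh powr (\<alpha> + \<beta> - 1)\<close>.
\<close>

definition young_recursion ::
  "real \<Rightarrow> real \<Rightarrow> real \<Rightarrow> real \<Rightarrow> nat \<Rightarrow> (nat \<Rightarrow> real) \<Rightarrow> (nat \<Rightarrow> 'v::real_normed_vector) \<Rightarrow>
   (nat \<Rightarrow> 'v \<Rightarrow>\<^sub>L 'x::real_normed_vector) \<Rightarrow> (nat \<Rightarrow> 'x) \<Rightarrow> real \<Rightarrow> real \<Rightarrow> bool" where
  "young_recursion A R \<alpha> \<beta> n t g S y b \<epsilon> \<longleftrightarrow>
     (\<forall>k l. k < l \<and> l \<le> n \<longrightarrow> t k < t l) \<and>
     (\<forall>k l. k \<le> l \<and> l \<le> n \<longrightarrow> norm (g l - g k) \<le> R * (t l - t k) powr \<beta>) \<and>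
     (\<forall>k\<le>n. norm (S k) \<le> A * (b + norm (y k))) \<and>
     (\<forall>k l. k \<le> l \<and> l \<le> n \<longrightarrow> norm (S l - S k)
        \<le> A * (norm (y l - y k) + (b + norm (y k) + norm (y l)) * (t l - t k) powr \<alpha>)) \<and>
     (\<forall>k<n. norm (y (Suc k) - y k - S k (g (Suc k) - g k)) \<le> \<epsilon> * (t (Suc k) - t k))"

text \<open>
  The three contributions to an increment of \<open>y\<close> scale like \<open>d powr (\<alpha> + \<beta>)\<close>,
  \<open>d powr \<beta>\<close> and \<open>d\<close>. On a short interval each is \<open>d powr \<alpha>\<close> with a common small factor.
\<close>

lemma powr_le_powr_mult_powr:
  fixes d h :: real
  assumes "0 < d" "d \<le> h" "h \<le> 1" "\<alpha> < \<beta>" "\<beta> \<le> p"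
  shows "d powr p \<le> d powr \<alpha> * h powr (\<beta> - \<alpha>)"
proof -
  have "d powr (p - \<alpha>) \<le> h powr (p - \<alpha>)"
    using assms by (intro powr_mono2) auto
  also have "\<dots> \<le> h powr (\<beta> - \<alpha>)"
    using assms by (intro powr_mono') auto
  finally have "d powr \<alpha> * d powr (p - \<alpha>) \<le> d powr \<alpha> * h powr (\<beta> - \<alpha>)"
    by (intro mult_left_mono) auto
  then show ?thesis by (simp flip: powr_add)
qed

text \<open>
  An absorption argument. With \<open>L\<close> the best Hoelder constant of \<open>y\<close> on the window from \<open>i\<close> to
  \<open>j\<close>, Young's inequality for the coefficients bounds \<open>L\<close> by a small factor times
  \<open>b + \<epsilon> + norm (y i) + L\<close>. The factor is at most \<open>1/2\<close> on windows of length \<open>h\<close>, and \<open>L\<close> is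
  finite since the window contains finitely many grid points, so \<open>L\<close> can be moved to the left.
\<close>

lemma young_recursion_local:
  fixes y :: "nat \<Rightarrow> 'x::real_normed_vector"
  assumes rec: "young_recursion A R \<alpha> \<beta> n t g S y b \<epsilon>"
    and exps: "0 < \<alpha>" "\<alpha> < \<beta>" "\<beta> \<le> 1" "1 < \<alpha> + \<beta>"
    and nonneg: "0 \<le> A" "0 \<le> R" "0 \<le> b" "0 \<le> \<epsilon>"
    and h: "0 < h" "h \<le> 1"
      "h powr (\<beta> - \<alpha>) * (A * R * (1 + 3 * young_const (\<alpha> + \<beta>)) + 1) \<le> 1 / 2"
    and ij: "i \<le> j" "j \<le> n" "t j - t i \<le> h"
    and kl: "i \<le> k" "k \<le> l" "l \<le> j"
  shows "norm (y l - y k) \<le> (b + \<epsilon> + norm (y i)) * (t l - t k) powr \<alpha>"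
proof -
  let ?\<kappa> = "young_const (\<alpha> + \<beta>)"
  have \<kappa>: "0 < ?\<kappa>" using young_const_pos exps by simp
  have mono: "t p < t q" if "p < q" "q \<le> n" for p q
    using rec that by (auto simp: young_recursion_def)
  have le: "t p \<le> t q" if "p \<le> q" "q \<le> n" for p q
    using mono[of p q] that by (cases "p = q") auto
  let ?I = "{(p, q). i \<le> p \<and> p < q \<and> q \<le> j}"
  let ?q = "\<lambda>(p, q). norm (y q - y p) / (t q - t p) powr \<alpha>"
  define L where "L = Max (insert 0 (?q ` ?I))"
  have fin: "finite (insert 0 (?q ` ?I))"
    by (rule finite.insertI, rule finite_imageI, rule finite_subset[of _ "{..j} \<times> {..j}"]) auto
  have "0 \<le> L" unfolding L_def by (intro Max_ge fin) auto
  have L: "norm (y q - y p) \<le> L * (t q - t p) powr \<alpha>" if "i \<le> p" "p \<le> q" "q \<le> j" for p q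
  proof (cases "p = q")
    case False
    then have "p < q" using that by simp
    then have "?q (p, q) \<le> L"
      unfolding L_def using that by (intro Max_ge fin) auto
    then show ?thesis using mono[of p q] \<open>p < q\<close> that ij by (simp add: divide_le_eq)
  qed simp
  define Y where "Y = norm (y i) + L"
  have Y: "norm (y p) \<le> Y" if "i \<le> p" "p \<le> j" for p
  proof -
    have "(t p - t i) powr \<alpha> \<le> 1"
      using that ij h exps le[of i p] le[of p j] by (intro powr_le1) auto
    then have "norm (y p - y i) \<le> L"
      using L[of i p] that \<open>0 \<le> L\<close> mult_left_le[of "(t p - t i) powr \<alpha>" L] by linarith
    then show ?thesis
      using norm_triangle_ineq[of "y p - y i" "y i"] by (simp add: Y_def)
  qed
  have "0 \<le> Y" using \<open>0 \<le> L\<close> by (simp add: Y_def)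
  define P where "P = A * (L + b + 2 * Y)"
  have "0 \<le> P" using nonneg \<open>0 \<le> L\<close> \<open>0 \<le> Y\<close> by (simp add: P_def)
  have S: "norm (S q - S p) \<le> P * (t q - t p) powr \<alpha>" if "i \<le> p" "p \<le> q" "q \<le> j" for p q
  proof -
    have "norm (S q - S p)
        \<le> A * (norm (y q - y p) + (b + norm (y p) + norm (y q)) * (t q - t p) powr \<alpha>)"
      using rec that ij by (simp add: young_recursion_def)
    also have "\<dots> \<le> A * (L * (t q - t p) powr \<alpha> + (b + Y + Y) * (t q - t p) powr \<alpha>)"
      using that nonneg
      by (intro mult_left_mono add_mono mult_right_mono L Y order_refl) auto
    finally show ?thesis by (simp add: P_def algebra_simps)
  qed
  define Q where "Q = A * R * (1 + 3 * ?\<kappa>) + 1"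
  define B where "B = b + \<epsilon> + norm (y i) + L"
  have "0 \<le> B" using nonneg \<open>0 \<le> L\<close> by (simp add: B_def)
  have "?q (p, q) \<le> h powr (\<beta> - \<alpha>) * Q * B" if pq: "i \<le> p" "p < q" "q \<le> j" for p q
  proof -
    define d where "d = t q - t p"
    have "0 < d" using mono[of p q] pq ij by (simp add: d_def)
    have "d \<le> h" using le[of i p] le[of q j] pq ij by (simp add: d_def)
    let ?H = "d powr \<alpha> * h powr (\<beta> - \<alpha>)"
    let ?r = "\<lambda>m. y (Suc m) - y m - S m (g (Suc m) - g m)"
    let ?E = "(\<Sum>m=p..<q. S m (g (Suc m) - g m)) - S p (g q - g p)"
    have pow: "d powr e \<le> ?H" if "\<beta> \<le> e" for e
      using \<open>0 < d\<close> \<open>d \<le> h\<close> h exps that by (intro powr_le_powr_mult_powr) auto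
    have "norm ?E \<le> ?\<kappa> * P * R * d powr (\<alpha> + \<beta>)"
      unfolding d_def using pq ij exps nonneg \<open>0 \<le> P\<close> rec
      by (intro discrete_young_loeve mono S) (auto simp: young_recursion_def)
    also have "\<dots> \<le> ?\<kappa> * P * R * ?H"
      using \<kappa> \<open>0 \<le> P\<close> nonneg exps by (intro mult_left_mono pow) auto
    finally have 1: "norm ?E \<le> ?\<kappa> * P * R * ?H" .
    have "norm (S p (g q - g p)) \<le> norm (S p) * norm (g q - g p)"
      by (rule norm_blinfun)
    also have "\<dots> \<le> (A * (b + Y)) * (R * ?H)"
    proof (intro mult_mono)
      have "norm (S p) \<le> A * (b + norm (y p))"
        using rec pq ij by (simp add: young_recursion_def)
      also have "\<dots> \<le> A * (b + Y)"
        using nonneg pq by (intro mult_left_mono add_mono Y) auto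
      finally show "norm (S p) \<le> A * (b + Y)" .
      have "norm (g q - g p) \<le> R * d powr \<beta>"
        using rec pq ij by (simp add: young_recursion_def d_def)
      also have "\<dots> \<le> R * ?H" using nonneg by (intro mult_left_mono pow) auto
      finally show "norm (g q - g p) \<le> R * ?H" .
    qed (use nonneg \<open>0 \<le> Y\<close> in auto)
    finally have 2: "norm (S p (g q - g p)) \<le> (A * (b + Y)) * (R * ?H)" .
    have "norm (\<Sum>m=p..<q. ?r m) \<le> (\<Sum>m=p..<q. \<epsilon> * (t (Suc m) - t m))"
      using rec pq ij by (intro sum_norm_le) (auto simp: young_recursion_def)
    also have "\<dots> = \<epsilon> * d powr 1"
      using pq \<open>0 < d\<close> by (simp add: d_def sum_Suc_diff' flip: sum_distrib_left)
    also have "\<dots> \<le> \<epsilon> * ?H" using nonneg exps by (intro mult_left_mono pow) auto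
    finally have 3: "norm (\<Sum>m=p..<q. ?r m) \<le> \<epsilon> * ?H" .
    have "y q - y p = (\<Sum>m=p..<q. y (Suc m) - y m)"
      using pq by (simp add: sum_Suc_diff')
    also have "\<dots> = ?E + S p (g q - g p) + (\<Sum>m=p..<q. ?r m)"
      by (simp add: sum_subtractf)
    also have "norm \<dots> \<le> norm ?E + norm (S p (g q - g p)) + norm (\<Sum>m=p..<q. ?r m)"
      by (intro norm_triangle_le add_mono order_refl)
    also have "\<dots> \<le> ?\<kappa> * P * R * ?H + (A * (b + Y)) * (R * ?H) + \<epsilon> * ?H"
      by (intro add_mono 1 2 3)
    also have "\<dots> = (?\<kappa> * P * R + A * (b + Y) * R + \<epsilon>) * ?H"
      by (simp add: algebra_simps)
    also have "\<dots> \<le> (Q * B) * ?H"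
    proof (rule mult_right_mono)
      have "P \<le> A * (3 * B)" "A * (b + Y) \<le> A * B"
        unfolding P_def Y_def B_def using nonneg \<open>0 \<le> L\<close> by (auto intro!: mult_left_mono)
      then have "?\<kappa> * P * R \<le> ?\<kappa> * (A * (3 * B)) * R" "A * (b + Y) * R \<le> A * B * R"
        using \<kappa> nonneg by (simp_all only: mult_left_mono mult_right_mono less_imp_le)
      moreover have "\<epsilon> \<le> B" using nonneg \<open>0 \<le> L\<close> by (simp add: B_def)
      ultimately have "?\<kappa> * P * R + A * (b + Y) * R + \<epsilon>
          \<le> ?\<kappa> * (A * (3 * B)) * R + A * B * R + B"
        by (intro add_mono)
      also have "\<dots> = Q * B" by (simp add: Q_def algebra_simps)
      finally show "?\<kappa> * P * R + A * (b + Y) * R + \<epsilon> \<le> Q * B" .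
    qed auto
    finally have "norm (y q - y p) \<le> (h powr (\<beta> - \<alpha>) * Q * B) * d powr \<alpha>"
      by (simp add: mult_ac)
    then show ?thesis using \<open>0 < d\<close> by (simp add: divide_le_eq flip: d_def)
  qed
  moreover have "0 \<le> h powr (\<beta> - \<alpha>) * Q * B"
    using \<open>0 \<le> B\<close> nonneg \<kappa> by (simp add: Q_def)
  ultimately have "L \<le> h powr (\<beta> - \<alpha>) * Q * B"
    unfolding L_def using fin by (subst Max_le_iff) auto
  also have "\<dots> \<le> 1 / 2 * B"
    using h(3) \<open>0 \<le> B\<close> by (intro mult_right_mono) (simp_all add: Q_def)
  finally have "L \<le> b + \<epsilon> + norm (y i)" by (simp add: B_def)
  then show ?thesis
    using L[OF kl] by (meson mult_right_mono order_trans powr_ge_zero)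
qed

text \<open>
  The window length at which the small factor in the absorption argument equals \<open>1/2\<close>.
\<close>

definition step_size :: "real \<Rightarrow> real \<Rightarrow> real \<Rightarrow> real \<Rightarrow> real" where
  "step_size A R \<alpha> \<beta> =
     (1 / (2 * (A * R * (1 + 3 * young_const (\<alpha> + \<beta>)) + 1))) powr (1 / (\<beta> - \<alpha>))"

lemma step_size:
  assumes "\<alpha> < \<beta>" "1 < \<alpha> + \<beta>" "0 \<le> A" "0 \<le> R"
  shows "0 < step_size A R \<alpha> \<beta>" "step_size A R \<alpha> \<beta> \<le> 1"
    "step_size A R \<alpha> \<beta> powr (\<beta> - \<alpha>) * (A * R * (1 + 3 * young_const (\<alpha> + \<beta>)) + 1) \<le> 1 / 2"
proof -
  define Q where "Q = A * R * (1 + 3 * young_const (\<alpha> + \<beta>)) + 1"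
  have "1 \<le> Q"
    using assms young_const_pos[of "\<alpha> + \<beta>"] by (simp add: Q_def)
  have h: "step_size A R \<alpha> \<beta> = (1 / (2 * Q)) powr (1 / (\<beta> - \<alpha>))"
    by (simp add: step_size_def Q_def)
  show "0 < step_size A R \<alpha> \<beta>" using \<open>1 \<le> Q\<close> by (simp add: h)
  show "step_size A R \<alpha> \<beta> \<le> 1"
    unfolding h using \<open>1 \<le> Q\<close> assms by (intro powr_le1) auto
  have "step_size A R \<alpha> \<beta> powr (\<beta> - \<alpha>) = 1 / (2 * Q)"
    unfolding h using \<open>1 \<le> Q\<close> assms by (simp add: powr_powr)
  then show "step_size A R \<alpha> \<beta> powr (\<beta> - \<alpha>) * (A * R * (1 + 3 * young_const (\<alpha> + \<beta>)) + 1) \<le> 1 / 2"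
    using \<open>1 \<le> Q\<close> by (simp flip: Q_def)
qed

text \<open>
  Over a window of length at most \<open>h\<close> the quantity \<open>norm y + b + \<epsilon>\<close> at most doubles. As the cells
  have length at most \<open>h / 2\<close>, from any grid point beyond \<open>t 0 + h\<close> one can go back by a distance
  between \<open>h / 2\<close> and \<open>h\<close>, so the number of doublings is at most \<open>1 + 2 (t k - t 0) / h\<close>.
\<close>

lemma young_recursion_sup:
  fixes y :: "nat \<Rightarrow> 'x::real_normed_vector"
  assumes rec: "young_recursion A R \<alpha> \<beta> n t g S y b \<epsilon>"
    and exps: "0 < \<alpha>" "\<alpha> < \<beta>" "\<beta> \<le> 1" "1 < \<alpha> + \<beta>"
    and nonneg: "0 \<le> A" "0 \<le> R" "0 \<le> b" "0 \<le> \<epsilon>"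
    and h: "h = step_size A R \<alpha> \<beta>"
    and fine: "\<And>k. k < n \<Longrightarrow> t (Suc k) - t k \<le> h / 2"
    and "k \<le> n"
  shows "norm (y k) + (b + \<epsilon>) \<le> (norm (y 0) + (b + \<epsilon>)) * 2 powr (1 + 2 * (t k - t 0) / h)"
  using \<open>k \<le> n\<close>
proof (induction k rule: less_induct)
  case (less k)
  let ?B = "b + \<epsilon>"
  have hpos: "0 < h" "h \<le> 1" unfolding h using step_size exps nonneg by auto
  have mono: "t p < t q" if "p < q" "q \<le> n" for p q
    using rec that by (auto simp: young_recursion_def)
  have le: "t p \<le> t q" if "p \<le> q" "q \<le> n" for p q
    using mono[of p q] that by (cases "p = q") auto
  have doubling: "norm (y k) + ?B \<le> 2 * (norm (y i) + ?B)" if "i \<le> k" "t k - t i \<le> h" for i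
  proof -
    have "norm (y k - y i) \<le> (?B + norm (y i)) * (t k - t i) powr \<alpha>"
      using that less.prems exps nonneg hpos step_size[of \<alpha> \<beta> A R]
      by (intro young_recursion_local[OF rec, where h = h and j = k]) (auto simp: h)
    also have "\<dots> \<le> (?B + norm (y i)) * 1"
      using that hpos le[of i k] less.prems nonneg exps
      by (intro mult_left_mono powr_le1) auto
    finally show ?thesis
      using norm_triangle_ineq[of "y k - y i" "y i"] by simp
  qed
  have B: "0 \<le> norm (y 0) + ?B" using nonneg by simp
  show ?case
  proof (cases "t k - t 0 \<le> h")
    case True
    have "norm (y k) + ?B \<le> (norm (y 0) + ?B) * 2 powr 1"
      using doubling[of 0] True by simp
    also have "\<dots> \<le> (norm (y 0) + ?B) * 2 powr (1 + 2 * (t k - t 0) / h)"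
      using B hpos le[of 0 k] less.prems by (intro mult_left_mono powr_mono) auto
    finally show ?thesis .
  next
    case False
    \<comment> \<open>The earliest grid point of the window of length \<open>h\<close> ending at \<open>k\<close>.\<close>
    define i where "i = (LEAST i. t k - t i \<le> h)"
    have i: "t k - t i \<le> h" 
      unfolding i_def by (rule LeastI[of "\<lambda>i. t k - t i \<le> h" k]) (use hpos in simp)
    have "i \<le> k" unfolding i_def by (rule Least_le) (use hpos in simp)
    have "i \<noteq> 0" using i False by metis
    then have "\<not> t k - t (i - 1) \<le> h"
      using not_less_Least[of "i - 1" "\<lambda>i. t k - t i \<le> h"] unfolding i_def[symmetric] by simp
    moreover have "t i - t (i - 1) \<le> h / 2"
      using fine[of "i - 1"] \<open>i \<noteq> 0\<close> \<open>i \<le> k\<close> less.prems by simp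
    ultimately have gap: "h / 2 \<le> t k - t i" by simp
    then have "i < k" using hpos \<open>i \<le> k\<close> by (cases "i = k") auto
    have "norm (y k) + ?B \<le> 2 * (norm (y i) + ?B)"
      using \<open>i \<le> k\<close> i by (rule doubling)
    also have "\<dots> \<le> 2 * ((norm (y 0) + ?B) * 2 powr (1 + 2 * (t i - t 0) / h))"
      using less.IH[OF \<open>i < k\<close>] \<open>i < k\<close> less.prems by simp
    also have "\<dots> = (norm (y 0) + ?B) * 2 powr (2 + 2 * (t i - t 0) / h)"
      by (simp add: powr_add)
    also have "\<dots> \<le> (norm (y 0) + ?B) * 2 powr (1 + 2 * (t k - t 0) / h)"
    proof (intro mult_left_mono powr_mono)
      have "(h + 2 * (t i - t 0)) / h \<le> 2 * (t k - t 0) / h"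
        using gap hpos by (intro divide_right_mono) auto
      then show "2 + 2 * (t i - t 0) / h \<le> 1 + 2 * (t k - t 0) / h"
        using hpos by (simp add: add_divide_distrib)
    qed (use B in auto)
    finally show ?thesis .
  qed
qed

text \<open>
  Over times longer than one window the Hoelder bound is deduced from the sup bound, at the price of
  dividing by the window length to the power \<open>\<alpha>\<close>.
\<close>

definition growth_const :: "real \<Rightarrow> real \<Rightarrow> real \<Rightarrow> real \<Rightarrow> real \<Rightarrow> real" where
  "growth_const T A R \<alpha> \<beta> =
     2 * 2 powr (1 + 2 * T / step_size A R \<alpha> \<beta>) / step_size A R \<alpha> \<beta> powr \<alpha>"

lemma growth_const_nonneg: "0 \<le> growth_const T A R \<alpha> \<beta>"
  by (simp add: growth_const_def)

text \<open>
  A discrete Gronwall lemma for Young recursions. The bound is proportional to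
  \<open>b + \<epsilon> + norm (y 0)\<close>: for \<open>b = 1\<close> it is an a priori estimate, and for \<open>b = 0\<close> and \<open>y 0 = 0\<close> it
  turns a consistency error \<open>\<epsilon>\<close> into a global error of the same order.
\<close>

lemma young_recursion_holder:
  fixes y :: "nat \<Rightarrow> 'x::real_normed_vector"
  assumes rec: "young_recursion A R \<alpha> \<beta> n t g S y b \<epsilon>"
    and exps: "0 < \<alpha>" "\<alpha> < \<beta>" "\<beta> \<le> 1" "1 < \<alpha> + \<beta>"
    and nonneg: "0 \<le> A" "0 \<le> R" "0 \<le> b" "0 \<le> \<epsilon>"
    and fine: "\<And>k. k < n \<Longrightarrow> t (Suc k) - t k \<le> step_size A R \<alpha> \<beta> / 2"
    and T: "t n - t 0 \<le> T"
    and kl: "k \<le> l" "l \<le> n"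
  shows "norm (y l - y k)
           \<le> growth_const T A R \<alpha> \<beta> * (b + \<epsilon> + norm (y 0)) * (t l - t k) powr \<alpha>"
proof -
  define h where "h = step_size A R \<alpha> \<beta>"
  define E where "E = 2 powr (1 + 2 * T / h)"
  let ?B = "b + \<epsilon>"
  have h: "0 < h" "h \<le> 1" unfolding h_def using step_size exps nonneg by auto
  have mono: "t p < t q" if "p < q" "q \<le> n" for p q
    using rec that by (auto simp: young_recursion_def)
  have le: "t p \<le> t q" if "p \<le> q" "q \<le> n" for p q
    using mono[of p q] that by (cases "p = q") auto
  have sup: "norm (y m) + ?B \<le> (?B + norm (y 0)) * E" if "m \<le> n" for m
  proof -
    have "norm (y m) + ?B \<le> (norm (y 0) + ?B) * 2 powr (1 + 2 * (t m - t 0) / h)"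
      using that exps nonneg fine by (intro young_recursion_sup[OF rec]) (auto simp: h_def)
    also have "\<dots> \<le> (norm (y 0) + ?B) * E"
      unfolding E_def using that h le[of m n] T nonneg
      by (intro mult_left_mono powr_mono) (auto simp: divide_right_mono)
    finally show ?thesis by (simp add: algebra_simps)
  qed
  have C: "growth_const T A R \<alpha> \<beta> = 2 * E / h powr \<alpha>"
    by (simp add: growth_const_def h_def E_def)
  have "h powr \<alpha> \<le> 1" using h exps by (intro powr_le1) auto
  have "0 < E" by (simp add: E_def)
  have E0: "0 \<le> (?B + norm (y 0)) * E" using nonneg \<open>0 < E\<close> by simp
  show ?thesis
  proof (cases "t l - t k \<le> h")
    case True
    have "norm (y l - y k) \<le> (?B + norm (y k)) * (t l - t k) powr \<alpha>"
      using True kl exps nonneg h step_size[of \<alpha> \<beta> A R]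
      by (intro young_recursion_local[OF rec, where h = h and j = l]) (auto simp: h_def)
    also have "\<dots> \<le> (2 * ((?B + norm (y 0)) * E) / h powr \<alpha>) * (t l - t k) powr \<alpha>"
    proof (rule mult_right_mono)
      have "?B + norm (y k) \<le> (?B + norm (y 0)) * E" using sup[of k] kl by simp
      also have "\<dots> \<le> 2 * ((?B + norm (y 0)) * E) / h powr \<alpha>"
        using E0 h \<open>h powr \<alpha> \<le> 1\<close> mult_right_le_one_le[of "(?B + norm (y 0)) * E" "h powr \<alpha>"]
        by (simp add: le_divide_eq)
      finally show "?B + norm (y k) \<le> 2 * ((?B + norm (y 0)) * E) / h powr \<alpha>" .
    qed simp
    finally show ?thesis by (simp add: C mult_ac)
  next
    case False
    then have "1 \<le> (t l - t k) powr \<alpha> / h powr \<alpha>"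
      using h exps by (simp add: le_divide_eq powr_mono2)
    have "norm (y l - y k) \<le> norm (y l) + norm (y k)" by (rule norm_triangle_ineq4)
    also have "\<dots> \<le> 2 * ((?B + norm (y 0)) * E)"
      using sup[of k] sup[of l] kl nonneg by simp
    also have "\<dots> \<le> 2 * ((?B + norm (y 0)) * E) * ((t l - t k) powr \<alpha> / h powr \<alpha>)"
      using E0 mult_left_mono[OF \<open>1 \<le> (t l - t k) powr \<alpha> / h powr \<alpha>\<close>, of "2 * ((?B + norm (y 0)) * E)"]
      by simp
    finally show ?thesis by (simp add: C mult_ac)
  qed
qed

section \<open>Partitions and fine grids\<close>

lemma increasing_upto:
  fixes u :: "nat \<Rightarrow> real"
  assumes "\<And>k. k < n \<Longrightarrow> u k < u (Suc k)" and "k < l" "l \<le> n"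
  shows "u k < u l"
  using \<open>k < l\<close> \<open>l \<le> n\<close>
proof (induction l)
  case (Suc l)
  show ?case
  proof (cases "k = l")
    case True
    then show ?thesis using assms(1)[of l] Suc.prems by simp
  next
    case False
    then have "u k < u l" using Suc by simp
    also have "u l < u (Suc l)" using assms(1)[of l] Suc.prems by simp
    finally show ?thesis .
  qed
qed simp

lemma increasing_upto_le:
  fixes u :: "nat \<Rightarrow> real"
  assumes "\<And>k. k < n \<Longrightarrow> u k < u (Suc k)" and "k \<le> l" "l \<le> n"
  shows "u k \<le> u l"
  using increasing_upto[of n u k l] assms by (cases "k = l") auto

lemma exists_fine_grid:
  fixes s t \<delta> :: real
  assumes "s < t" "0 < \<delta>"
  obtains u :: "nat \<Rightarrow> real" and n where "0 < n" "u 0 = s" "u n = t"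
    "\<And>k. k < n \<Longrightarrow> u k < u (Suc k)" "\<And>k. k < n \<Longrightarrow> u (Suc k) - u k \<le> \<delta>"
proof -
  obtain N :: nat where N: "(t - s) / \<delta> < real N"
    using reals_Archimedean2 by blast
  have "0 < real N" using N assms by (smt (verit) divide_pos_pos)
  define u where "u k = s + real k * ((t - s) / real N)" for k
  have step: "u (Suc k) - u k = (t - s) / real N" for k
    by (simp add: u_def algebra_simps add_divide_distrib diff_divide_distrib)
  have "0 < (t - s) / real N" "(t - s) / real N \<le> \<delta>"
    using N \<open>0 < real N\<close> assms by (auto simp: field_simps)
  then show thesis
    using \<open>0 < real N\<close> step by (intro that[of N u]) (auto simp: u_def, smt (verit))
qed

text \<open>
  The integrals up to \<open>s\<close> and up to \<open>t\<close> can be compared on one grid of \<open>[0,t]\<close> whose initial segment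
  is a grid of \<open>[0,s]\<close>. For \<open>s = 0\<close> that segment is a single point.
\<close>

lemma exists_fine_grid_through:
  fixes s t \<delta> :: real
  assumes "0 \<le> s" "s < t" "0 < \<delta>"
  obtains u :: "nat \<Rightarrow> real" and m n where "m < n" "u 0 = 0" "u m = s" "u n = t"
    "\<And>k. k < n \<Longrightarrow> u k < u (Suc k)" "\<And>k. k < n \<Longrightarrow> u (Suc k) - u k \<le> \<delta>"
proof -
  obtain v and m :: nat where v: "v 0 = 0" "v m = s"
    "\<And>k. k < m \<Longrightarrow> v k < v (Suc k)" "\<And>k. k < m \<Longrightarrow> v (Suc k) - v k \<le> \<delta>"
  proof (cases "s = 0")
    case True
    show thesis by (rule that[of "\<lambda>_. 0" 0]) (auto simp: True)
  next
    case False
    then show thesis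
      using exists_fine_grid[of 0 s \<delta>] assms that by (metis less_eq_real_def)
  qed
  obtain w and n :: nat where w: "0 < n" "w 0 = s" "w n = t"
    "\<And>k. k < n \<Longrightarrow> w k < w (Suc k)" "\<And>k. k < n \<Longrightarrow> w (Suc k) - w k \<le> \<delta>"
    using exists_fine_grid[of s t \<delta>] assms by metis
  define u where "u k = (if k \<le> m then v k else w (k - m))" for k
  have u_right: "u k = w (k - m)" if "m \<le> k" for k
    using that v(2) w(2) by (auto simp: u_def)
  have step: "u k < u (Suc k) \<and> u (Suc k) - u k \<le> \<delta>" if "k < m + n" for k
  proof (cases "k < m")
    case True
    then show ?thesis using v by (simp add: u_def)
  next
    case False
    then show ?thesis
      using that w(4,5)[of "k - m"] by (simp add: u_right Suc_diff_le)
  qed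
  show thesis
  proof (rule that[of m "m + n" u])
    show "m < m + n" "u 0 = 0" "u m = s" "u (m + n) = t"
      using v w by (auto simp: u_right u_def)
  qed (use step in auto)
qed

lemma mesh_nonneg: "0 \<le> mesh \<pi>"
  unfolding mesh_def by (intro Max_ge) auto

lemma mesh_le_iff:
  assumes "0 \<le> \<delta>"
  shows "mesh \<pi> \<le> \<delta> \<longleftrightarrow> (\<forall>k<length \<pi> - 1. \<bar>\<pi> ! Suc k - \<pi> ! k\<bar> \<le> \<delta>)"
  unfolding mesh_def using assms by (subst Max_le_iff) auto

lemma eventually_mesh_to_zero:
  "eventually P (mesh_to_zero a b) \<longleftrightarrow> (\<exists>\<delta>>0. \<forall>\<pi>. is_partition a b \<pi> \<and> mesh \<pi> < \<delta> \<longrightarrow> P \<pi>)"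
proof -
  have "eventually P (mesh_to_zero a b) \<longleftrightarrow>
      (\<exists>Q. eventually Q (nhds 0) \<and> (\<forall>\<pi>. Q (mesh \<pi>) \<longrightarrow> is_partition a b \<pi> \<longrightarrow> P \<pi>))"
    by (simp add: mesh_to_zero_def eventually_inf_principal eventually_filtercomap)
  also have "\<dots> \<longleftrightarrow> (\<exists>\<delta>>0. \<forall>\<pi>. is_partition a b \<pi> \<and> mesh \<pi> < \<delta> \<longrightarrow> P \<pi>)" (is "?L \<longleftrightarrow> ?R")
  proof
    assume ?L
    then obtain Q \<delta> where "0 < \<delta>" "\<And>x. dist x (0::real) < \<delta> \<Longrightarrow> Q x"
      "\<And>\<pi>. Q (mesh \<pi>) \<Longrightarrow> is_partition a b \<pi> \<Longrightarrow> P \<pi>"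
      unfolding eventually_nhds_metric by blast
    then show ?R using mesh_nonneg by (intro exI[of _ \<delta>]) (auto simp: dist_real_def)
  next
    assume ?R
    then obtain \<delta> where \<delta>: "0 < \<delta>" "\<And>\<pi>. is_partition a b \<pi> \<Longrightarrow> mesh \<pi> < \<delta> \<Longrightarrow> P \<pi>"
      by blast
    have "eventually (\<lambda>x. x < \<delta>) (nhds (0::real))"
      using \<delta>(1) by (rule eventually_nhds_in_open[of "{..<\<delta>}", simplified])
    then show ?L using \<delta>(2) by blast
  qed
  finally show ?thesis .
qed

lemma filterlim_mesh: "(mesh \<longlongrightarrow> 0) (mesh_to_zero a b)"
  unfolding mesh_to_zero_def
  by (rule filterlim_mono[OF filterlim_filtercomap order_refl]) simp

lemma is_partition_grid:
  fixes u :: "nat \<Rightarrow> real"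
  assumes "\<And>k. k < n \<Longrightarrow> u k < u (Suc k)"
  shows "is_partition (u 0) (u n) (map u [0..<Suc n])"
  unfolding is_partition_def
proof (intro conjI)
  show "sorted_wrt (<) (map u [0..<Suc n])"
    using increasing_upto[of n u] assms
    by (auto simp: sorted_wrt_iff_nth_less simp del: upt_Suc)
qed (auto simp: hd_map simp del: upt_Suc, simp_all)

lemma mesh_grid_le:
  fixes u :: "nat \<Rightarrow> real"
  assumes "0 \<le> \<delta>" "\<And>k. k < n \<Longrightarrow> u k < u (Suc k)" "\<And>k. k < n \<Longrightarrow> u (Suc k) - u k \<le> \<delta>"
  shows "mesh (map u [0..<Suc n]) \<le> \<delta>"
proof -
  have "\<bar>u (Suc k) - u k\<bar> \<le> \<delta>" if "k < n" for k
    using assms(2,3)[OF that] by linarith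
  then show ?thesis
    using assms(1) by (auto simp: mesh_le_iff nth_append simp del: upt_Suc)
qed

lemma young_sum_grid:
  "young_sum f g (map u [0..<Suc n]) = (\<Sum>k<n. f (u k) (g (u (Suc k)) - g (u k)))"
  by (auto simp: young_sum_def simp del: upt_Suc intro!: sum.cong)

section \<open>Hoelder bounds with real constants\<close>

text \<open>
  A real-valued form of the bound \<open>L\<close> on the Hoelder seminorm. It is restricted to ordered pairs of
  times, the form in which grid estimates use it.
\<close>

definition holder_bounded :: "real \<Rightarrow> real \<Rightarrow> real \<Rightarrow> (real \<Rightarrow> 'a::real_normed_vector) \<Rightarrow> bool" where
  "holder_bounded T \<alpha> L f \<longleftrightarrow>
     (\<forall>s t. 0 \<le> s \<and> s \<le> t \<and> t \<le> T \<longrightarrow> norm (f t - f s) \<le> L * (t - s) powr \<alpha>)"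

lemma holder_boundedD:
  "holder_bounded T \<alpha> L f \<Longrightarrow> 0 \<le> s \<Longrightarrow> s \<le> t \<Longrightarrow> t \<le> T \<Longrightarrow> norm (f t - f s) \<le> L * (t - s) powr \<alpha>"
  by (simp add: holder_bounded_def)

lemma holder_boundedD_abs:
  assumes "holder_bounded T \<alpha> L f" "s \<in> {0..T}" "t \<in> {0..T}"
  shows "norm (f t - f s) \<le> L * \<bar>t - s\<bar> powr \<alpha>"
  using holder_boundedD[OF assms(1), of s t] holder_boundedD[OF assms(1), of t s] assms(2,3)
  by (cases "s \<le> t") (auto simp: norm_minus_commute abs_minus_commute)

lemma holder_seminorm_le_iff:
  fixes f :: "real \<Rightarrow> 'a::real_normed_vector"
  assumes "0 \<le> L"
  shows "holder_seminorm T \<alpha> f \<le> ennreal L \<longleftrightarrow> holder_bounded T \<alpha> L f"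
proof
  assume le: "holder_seminorm T \<alpha> f \<le> ennreal L"
  show "holder_bounded T \<alpha> L f"
    unfolding holder_bounded_def
  proof (intro allI impI)
    fix s t assume st: "0 \<le> s \<and> s \<le> t \<and> t \<le> T"
    show "norm (f t - f s) \<le> L * (t - s) powr \<alpha>"
    proof (cases "s = t")
      case False
      then have "ennreal (norm (f t - f s) / \<bar>t - s\<bar> powr \<alpha>) \<le> holder_seminorm T \<alpha> f"
        unfolding holder_seminorm_def using st by (intro SUP_upper2[of "(s, t)"]) auto
      then have "norm (f t - f s) / \<bar>t - s\<bar> powr \<alpha> \<le> L"
        using le assms by (metis ennreal_le_iff order_trans)
      then show ?thesis using False st by (simp add: divide_le_eq)
    qed simp
  qed
next
  assume f: "holder_bounded T \<alpha> L f"
  show "holder_seminorm T \<alpha> f \<le> ennreal L"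
    unfolding holder_seminorm_def
  proof (rule SUP_least, clarsimp)
    fix s t assume "0 \<le> s" "s \<le> T" "0 \<le> t" "t \<le> T" "s \<noteq> t"
    then show "ennreal (norm (f t - f s) / \<bar>t - s\<bar> powr \<alpha>) \<le> ennreal L"
      using holder_boundedD_abs[OF f, of s t] assms
      by (intro ennreal_leI) (auto simp: divide_le_eq)
  qed
qed

lemma holder_norm_le:
  assumes "holder_bounded T \<alpha> L f" "\<And>t. t \<in> {0..T} \<Longrightarrow> norm (f t) \<le> B" "0 \<le> B" "0 \<le> L"
  shows "holder_norm T \<alpha> f \<le> ennreal (B + L)"
proof -
  have "(SUP s\<in>{0..T}. ennreal (norm (f s))) \<le> ennreal B"
    using assms by (intro SUP_least ennreal_leI) auto
  moreover have "holder_seminorm T \<alpha> f \<le> ennreal L"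
    using assms by (simp add: holder_seminorm_le_iff)
  ultimately show ?thesis
    unfolding holder_norm_def using assms by (simp add: add_mono ennreal_plus)
qed

lemma holder_norm_leD:
  assumes "holder_norm T \<alpha> f \<le> ennreal R" "0 \<le> R"
  shows "holder_bounded T \<alpha> R f" "t \<in> {0..T} \<Longrightarrow> norm (f t) \<le> R"
proof -
  have "holder_seminorm T \<alpha> f \<le> holder_norm T \<alpha> f"
    by (simp add: holder_norm_def)
  then show "holder_bounded T \<alpha> R f"
    using assms by (metis holder_seminorm_le_iff order_trans)
  assume "t \<in> {0..T}"
  then have "ennreal (norm (f t)) \<le> (SUP s\<in>{0..T}. ennreal (norm (f s)))"
    by (rule SUP_upper)
  also have "\<dots> \<le> holder_norm T \<alpha> f" by (simp add: holder_norm_def)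
  finally show "norm (f t) \<le> R" using assms by (metis ennreal_le_iff order_trans)
qed

lemma holder_spaceE:
  assumes "f \<in> holder_space T \<alpha>"
  obtains R where "0 \<le> R" "holder_norm T \<alpha> f \<le> ennreal R"
proof (rule that[of "enn2real (holder_norm T \<alpha> f)"])
  show "holder_norm T \<alpha> f \<le> ennreal (enn2real (holder_norm T \<alpha> f))"
    using assms by (simp add: holder_space_def)
qed simp

section \<open>Increments of the Young integral\<close>

text \<open>
  The Young--Loeve estimate: the discrete inequality holds on every grid with the same constant, hence it
  passes to the limit of vanishing mesh.
\<close>

lemma young_integral_increment:
  fixes f :: "real \<Rightarrow> 'v::banach \<Rightarrow>\<^sub>L 'x::banach"
  assumes I: "has_young_integral f g 0 s I" and J: "has_young_integral f g 0 t J"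
    and st: "0 \<le> s" "s \<le> t" "t \<le> T"
    and f: "holder_bounded T \<alpha> P f" and g: "holder_bounded T \<beta> R g"
    and exps: "0 < \<alpha>" "0 < \<beta>" "1 < \<alpha> + \<beta>" and "0 \<le> P" "0 \<le> R"
  shows "norm (J - I - f s (g t - g s)) \<le> young_const (\<alpha> + \<beta>) * P * R * (t - s) powr (\<alpha> + \<beta>)"
    (is "_ \<le> ?K")
proof (rule field_le_epsilon)
  fix e :: real assume "0 < e"
  then have "0 < e / 2" by simp
  have "\<exists>\<delta>>0. \<forall>\<pi>. is_partition 0 s \<pi> \<and> mesh \<pi> < \<delta> \<longrightarrow> dist (young_sum f g \<pi>) I < e / 2"
    using tendstoD[OF I[unfolded has_young_integral_def] \<open>0 < e / 2\<close>]
    by (simp add: eventually_mesh_to_zero)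
  then obtain \<delta>1 where \<delta>1: "0 < \<delta>1"
    "\<And>\<pi>. is_partition 0 s \<pi> \<Longrightarrow> mesh \<pi> < \<delta>1 \<Longrightarrow> dist (young_sum f g \<pi>) I < e / 2"
    by blast
  have "\<exists>\<delta>>0. \<forall>\<pi>. is_partition 0 t \<pi> \<and> mesh \<pi> < \<delta> \<longrightarrow> dist (young_sum f g \<pi>) J < e / 2"
    using tendstoD[OF J[unfolded has_young_integral_def] \<open>0 < e / 2\<close>]
    by (simp add: eventually_mesh_to_zero)
  then obtain \<delta>2 where \<delta>2: "0 < \<delta>2"
    "\<And>\<pi>. is_partition 0 t \<pi> \<Longrightarrow> mesh \<pi> < \<delta>2 \<Longrightarrow> dist (young_sum f g \<pi>) J < e / 2"
    by blast
  define \<delta> where "\<delta> = min \<delta>1 \<delta>2 / 2"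
  have "0 < \<delta>" "\<delta> < \<delta>1" "\<delta> < \<delta>2" using \<delta>1(1) \<delta>2(1) by (auto simp: \<delta>_def)
  obtain u :: "nat \<Rightarrow> real" and m n where u: "m \<le> n" "u 0 = 0" "u m = s" "u n = t"
    "\<And>k. k < n \<Longrightarrow> u k < u (Suc k)" "\<And>k. k < n \<Longrightarrow> u (Suc k) - u k \<le> \<delta>"
  \<comment> \<open>In the degenerate case both integrals are compared on the same grid of \<open>[0,s]\<close>, obtained by cutting a longer one.\<close>
  proof (cases "s = t")
    case True
    obtain u :: "nat \<Rightarrow> real" and m n where "m < n" "u 0 = 0" "u m = s" "u n = s + 1"
      "\<And>k. k < n \<Longrightarrow> u k < u (Suc k)" "\<And>k. k < n \<Longrightarrow> u (Suc k) - u k \<le> \<delta>"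
      by (rule exists_fine_grid_through[of s "s + 1" \<delta>]) (use st \<open>0 < \<delta>\<close> in auto)
    then show thesis using that[of m m u] True by auto
  next
    case False
    then have "s < t" using st by simp
    then show thesis
      using exists_fine_grid_through[of s t \<delta>] st \<open>0 < \<delta>\<close> that by (metis less_imp_le)
  qed
  note le = increasing_upto_le[of n u, OF u(5)]
  have bounds: "0 \<le> u k" "u k \<le> T" if "k \<le> n" for k
    using le[of 0 k] le[of k n] u that st by auto
  let ?a = "\<lambda>k. f (u k) (g (u (Suc k)) - g (u k))"
  have "dist (young_sum f g (map u [0..<Suc m])) I < e / 2"
  proof (rule \<delta>1(2))
    show "is_partition 0 s (map u [0..<Suc m])"
      using is_partition_grid[of m u] u by auto
    show "mesh (map u [0..<Suc m]) < \<delta>1"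
      using mesh_grid_le[of \<delta> m u] u \<open>0 < \<delta>\<close> \<open>\<delta> < \<delta>1\<close> by force
  qed
  then have 1: "norm ((\<Sum>k<m. ?a k) - I) < e / 2"
    unfolding young_sum_grid by (simp add: dist_norm)
  have "dist (young_sum f g (map u [0..<Suc n])) J < e / 2"
  proof (rule \<delta>2(2))
    show "is_partition 0 t (map u [0..<Suc n])"
      using is_partition_grid[of n u] u by auto
    show "mesh (map u [0..<Suc n]) < \<delta>2"
      using mesh_grid_le[of \<delta> n u] u \<open>0 < \<delta>\<close> \<open>\<delta> < \<delta>2\<close> by force
  qed
  then have 2: "norm ((\<Sum>k<n. ?a k) - J) < e / 2"
    unfolding young_sum_grid by (simp add: dist_norm)
  have 3: "norm ((\<Sum>k=m..<n. ?a k) - f (u m) (g (u n) - g (u m)))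
      \<le> young_const (\<alpha> + \<beta>) * P * R * (u n - u m) powr (\<alpha> + \<beta>)"
  proof (rule discrete_young_loeve)
    fix k l assume kl: "m \<le> k" "k \<le> l" "l \<le> n"
    show "norm (f (u l) - f (u k)) \<le> P * (u l - u k) powr \<alpha>"
      using kl bounds le by (intro holder_boundedD[OF f]) auto
    show "norm (g (u l) - g (u k)) \<le> R * (u l - u k) powr \<beta>"
      using kl bounds le by (intro holder_boundedD[OF g]) auto
  next
    fix k l assume "m \<le> k" "k < l" "l \<le> n"
    then show "u k < u l" using increasing_upto[of n u] u(5) by auto
  qed (use assms u in auto)
  have "(\<Sum>k<n. ?a k) = (\<Sum>k<m. ?a k) + (\<Sum>k=m..<n. ?a k)"
    using u(1) by (simp add: lessThan_atLeast0 sum.atLeastLessThan_concat)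
  then have eq: "J - I - f s (g t - g s) =
      ((\<Sum>k=m..<n. ?a k) - f (u m) (g (u n) - g (u m))) - ((\<Sum>k<n. ?a k) - J) + ((\<Sum>k<m. ?a k) - I)"
    using u by simp
  have "norm (J - I - f s (g t - g s)) \<le> norm ((\<Sum>k=m..<n. ?a k) - f (u m) (g (u n) - g (u m)))
      + norm ((\<Sum>k<n. ?a k) - J) + norm ((\<Sum>k<m. ?a k) - I)"
    unfolding eq by (rule order_trans[OF norm_triangle_ineq add_right_mono[OF norm_triangle_ineq4]])
  then show "norm (J - I - f s (g t - g s)) \<le> ?K + e"
    using 1 2 3 unfolding u by linarith
qed

section \<open>Coefficients along a path\<close>

text \<open>
  The second-order increment is the increment over \<open>h\<close> of \<open>\<lambda>z. F (p + z) - G (q + z)\<close>, so the mean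
  value inequality needs only a bound on the difference of the derivatives.
\<close>

lemma double_increment_bound:
  fixes F G :: "'x::real_normed_vector \<Rightarrow> 'e::real_normed_vector"
    and F' G' :: "'x \<Rightarrow> 'x \<Rightarrow>\<^sub>L 'e"
  assumes F: "\<And>z. (F has_derivative F' z) (at z)" and G: "\<And>z. (G has_derivative G' z) (at z)"
    and B: "\<And>r. 0 \<le> r \<Longrightarrow> r \<le> 1 \<Longrightarrow> norm (F' (p + r *\<^sub>R h) - G' (q + r *\<^sub>R h)) \<le> B"
  shows "norm ((F (p + h) - F p) - (G (q + h) - G q)) \<le> B * norm h"
proof -
  define H where "H z = F (p + z) - G (q + z)" for z
  have "norm (H (0 + h) - H 0) \<le> norm h * B"
  proof (rule differentiable_bound_segment[where G = UNIV])
    fix z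
    have shift: "((\<lambda>v. c + v) has_derivative (\<lambda>v. v)) (at z)" for c :: 'x
      by (auto intro!: derivative_eq_intros)
    have "(H has_derivative (\<lambda>v. F' (p + z) v - G' (q + z) v)) (at z)"
      unfolding H_def
      by (intro has_derivative_diff has_derivative_compose[OF shift F] has_derivative_compose[OF shift G])
    then show "(H has_derivative blinfun_apply (F' (p + z) - G' (q + z))) (at z within UNIV)"
      by (simp add: minus_blinfun.rep_eq)
  next
    fix r :: real assume "r \<in> {0..1}"
    then show "onorm (blinfun_apply (F' (p + (0 + r *\<^sub>R h)) - G' (q + (0 + r *\<^sub>R h)))) \<le> B"
      using B[of r] by (simp flip: norm_blinfun.rep_eq)
  qed auto
  then show ?thesis by (simp add: H_def algebra_simps)
qed

text \<open>
  The regularity in time and space that remains of a nice function after a path \<open>w\<close> has been inserted: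
  the Hoelder bound of \<open>w\<close> turns the dependence on \<open>w\<close> into a dependence on time.
\<close>

definition growth_lipschitz ::
  "real \<Rightarrow> real \<Rightarrow> real \<Rightarrow> (real \<Rightarrow> 'x::real_normed_vector \<Rightarrow> 'e::real_normed_vector) \<Rightarrow> bool" where
  "growth_lipschitz T \<alpha> A F \<longleftrightarrow>
     (\<forall>s\<in>{0..T}. \<forall>t\<in>{0..T}. \<forall>p q. norm (F t p - F s q)
        \<le> A * (norm (p - q) + (1 + norm p + norm q) * \<bar>t - s\<bar> powr \<alpha>))"

lemma growth_lipschitzD:
  assumes "growth_lipschitz T \<alpha> A F" "0 \<le> s" "s \<le> t" "t \<le> T"
  shows "norm (F t p - F s q) \<le> A * (norm (p - q) + (1 + norm p + norm q) * (t - s) powr \<alpha>)"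
  using assms(1)[unfolded growth_lipschitz_def, rule_format, of s t p q] assms(2-4) by simp

lemma exists_bound_on_compact:
  fixes c :: "'a::topological_space \<Rightarrow> real"
  assumes "continuous_on UNIV c" "compact S"
  obtains K where "\<And>z. z \<in> S \<Longrightarrow> c z \<le> K"
proof -
  have "compact (c ` S)"
    using assms by (intro compact_continuous_image) (auto intro: continuous_on_subset)
  then have "bdd_above (c ` S)"
    by (simp add: compact_imp_bounded bounded_imp_bdd_above)
  then show thesis using that by (auto simp: bdd_above_def)
qed

lemma growth_lipschitz_along_path:
  fixes F :: "real \<Rightarrow> 'w::real_normed_vector \<Rightarrow> 'x::real_normed_vector \<Rightarrow> 'e::real_normed_vector"
  assumes F: "locally_lipschitz_growth c F" "time_holder_growth \<alpha> c' F"
    and c: "\<And>t r r'. t \<in> {0..T} \<Longrightarrow> r \<in> {0..R} \<Longrightarrow> r' \<in> {0..R} \<Longrightarrow> c (t, r, r') \<le> K"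
    and c': "\<And>r. r \<in> {0..R} \<Longrightarrow> c' r \<le> K"
    and w: "holder_norm T \<alpha> w \<le> ennreal R" and "0 \<le> R" "0 \<le> K"
  shows "growth_lipschitz T \<alpha> (K * (R + 1)) (\<lambda>t. F t (w t))"
  unfolding growth_lipschitz_def
proof (intro ballI allI)
  fix s t and p q :: 'x
  assume s: "s \<in> {0..T}" and t: "t \<in> {0..T}"
  let ?d = "\<bar>t - s\<bar> powr \<alpha>"
  have w_le: "norm (w s) \<le> R" "norm (w t) \<le> R"
    using holder_norm_leD(2)[OF w \<open>0 \<le> R\<close>] s t by auto
  have w_diff: "norm (w t - w s) \<le> R * ?d"
    using holder_boundedD_abs[OF holder_norm_leD(1)[OF w \<open>0 \<le> R\<close>] s t] .
  have "norm (F t (w t) p - F t (w s) q)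
      \<le> c (t, norm (w t), norm (w s)) * (norm (p - q) + (1 + norm p + norm q) * norm (w t - w s))"
    using F(1) by (auto simp: locally_lipschitz_growth_def)
  also have "\<dots> \<le> K * (norm (p - q) + (1 + norm p + norm q) * (R * ?d))"
    using w_le w_diff t c \<open>0 \<le> K\<close> by (intro mult_mono add_mono) auto
  finally have 1: "norm (F t (w t) p - F t (w s) q)
      \<le> K * (norm (p - q) + (1 + norm p + norm q) * (R * ?d))" .
  have "norm (F t (w s) q - F s (w s) q) \<le> c' (norm (w s)) * (1 + norm q) * ?d"
    using F(2) by (auto simp: time_holder_growth_def)
  also have "\<dots> \<le> K * (1 + norm p + norm q) * ?d"
    using w_le c' \<open>0 \<le> K\<close> by (intro mult_right_mono mult_mono) auto
  finally have 2: "norm (F t (w s) q - F s (w s) q) \<le> K * (1 + norm p + norm q) * ?d" .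
  have "norm (F t (w t) p - F s (w s) q)
      \<le> norm (F t (w t) p - F t (w s) q) + norm (F t (w s) q - F s (w s) q)"
    using norm_triangle_ineq[of "F t (w t) p - F t (w s) q" "F t (w s) q - F s (w s) q"] by simp
  also have "\<dots> \<le> K * (norm (p - q) + (1 + norm p + norm q) * (R * ?d)) + K * (1 + norm p + norm q) * ?d"
    using 1 2 by (rule add_mono)
  also have "\<dots> = K * norm (p - q) + K * (R + 1) * ((1 + norm p + norm q) * ?d)"
    by (simp add: algebra_simps)
  also have "\<dots> \<le> K * (R + 1) * norm (p - q) + K * (R + 1) * ((1 + norm p + norm q) * ?d)"
    using \<open>0 \<le> K\<close> \<open>0 \<le> R\<close> by (intro add_right_mono mult_right_mono) (auto simp: algebra_simps)
  finally show "norm (F t (w t) p - F s (w s) q)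
      \<le> K * (R + 1) * (norm (p - q) + (1 + norm p + norm q) * ?d)"
    by (simp add: algebra_simps)
qed

section \<open>The Young equation and its Euler scheme\<close>

text \<open>
  Bounds for all solutions and Euler schemes that start in the ball of radius \<open>\<rho>\<close>. They are
  functions of the numerical parameters alone, which makes the final error estimate uniform.
\<close>

definition apriori_sup :: "real \<Rightarrow> real \<Rightarrow> real \<Rightarrow> real \<Rightarrow> real \<Rightarrow> real \<Rightarrow> real" where
  "apriori_sup T A R \<alpha> \<beta> \<rho> = \<rho> + growth_const T A R \<alpha> \<beta> * (2 + \<rho>) * T powr \<alpha>"

definition apriori_holder :: "real \<Rightarrow> real \<Rightarrow> real \<Rightarrow> real \<Rightarrow> real \<Rightarrow> real \<Rightarrow> real" where
  "apriori_holder T A R \<alpha> \<beta> \<rho> = growth_const T A R \<alpha> \<beta> * (2 + apriori_sup T A R \<alpha> \<beta> \<rho>)"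

text \<open>
  The path \<open>w\<close> no longer appears: \<open>V t\<close> stands for \<open>\<sigma> t (w t)\<close> and \<open>D t\<close> for its derivative.
\<close>

locale young_equation =
  fixes T \<alpha> \<beta> A R :: real
    and V :: "real \<Rightarrow> 'x::banach \<Rightarrow> 'v::banach \<Rightarrow>\<^sub>L 'x"
    and D :: "real \<Rightarrow> 'x \<Rightarrow> 'x \<Rightarrow>\<^sub>L ('v \<Rightarrow>\<^sub>L 'x)"
    and g :: "real \<Rightarrow> 'v"
  assumes T_pos: "0 < T"
    and exps: "0 < \<alpha>" "\<alpha> < \<beta>" "\<beta> \<le> 1" "1 < \<alpha> + \<beta>"
    and A_nonneg: "0 \<le> A" and R_nonneg: "0 \<le> R"
    and V_bounded: "norm (V t p) \<le> A"
    and V_growth: "growth_lipschitz T \<alpha> A V"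
    and V_deriv: "(V t has_derivative D t p) (at p)"
    and D_growth: "growth_lipschitz T \<alpha> A D"
    and g_holder: "holder_bounded T \<beta> R g"
begin

definition solution :: "'x \<Rightarrow> (real \<Rightarrow> 'x) \<Rightarrow> bool" where
  "solution a x \<longleftrightarrow> x \<in> holder_space T \<alpha> \<and>
     (\<forall>t\<in>{0..T}. \<exists>I. has_young_integral (\<lambda>s. V s (x s)) g 0 t I \<and> x t = a + I)"

text \<open>
  Euler schemes with an error of at most the step length per step. The exact solution, sampled on a
  sufficiently fine grid, is such a scheme as well, so one estimate serves both.
\<close>

lemma perturbed_euler_holder:
  assumes incr: "\<And>k. k < n \<Longrightarrow> t k < t (Suc k)" and range: "0 \<le> t 0" "t n \<le> T"
    and fine: "\<And>k. k < n \<Longrightarrow> t (Suc k) - t k \<le> step_size A R \<alpha> \<beta> / 2"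
    and rem: "\<And>k. k < n \<Longrightarrow>
      norm (y (Suc k) - y k - V (t k) (y k) (g (t (Suc k)) - g (t k))) \<le> t (Suc k) - t k"
    and kl: "k \<le> l" "l \<le> n"
  shows "norm (y l - y k) \<le> growth_const T A R \<alpha> \<beta> * (2 + norm (y 0)) * (t l - t k) powr \<alpha>"
proof -
  note le = increasing_upto_le[of n t, OF incr]
  have bounds: "0 \<le> t k" "t k \<le> T" if "k \<le> n" for k
    using le[of 0 k] le[of k n] range that by auto
  have "young_recursion A R \<alpha> \<beta> n t (\<lambda>k. g (t k)) (\<lambda>k. V (t k) (y k)) y 1 1"
    unfolding young_recursion_def
  proof (intro conjI allI impI)
    fix k l assume "k < l \<and> l \<le> n"
    then show "t k < t l" using increasing_upto[of n t] incr by auto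
  next
    fix k l assume kl: "k \<le> l \<and> l \<le> n"
    then have tkl: "0 \<le> t k" "t k \<le> t l" "t l \<le> T" using bounds le by auto
    then show "norm (g (t l) - g (t k)) \<le> R * (t l - t k) powr \<beta>"
      by (rule holder_boundedD[OF g_holder])
    show "norm (V (t l) (y l) - V (t k) (y k))
        \<le> A * (norm (y l - y k) + (1 + norm (y k) + norm (y l)) * (t l - t k) powr \<alpha>)"
      using growth_lipschitzD[OF V_growth tkl, of "y l" "y k"] by (simp add: add_ac)
  next
    fix k
    have "norm (V (t k) (y k)) \<le> A * 1" using V_bounded by simp
    also have "\<dots> \<le> A * (1 + norm (y k))" using A_nonneg by (intro mult_left_mono) auto
    finally show "norm (V (t k) (y k)) \<le> A * (1 + norm (y k))" .
  next
    fix k assume "k < n"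
    then show "norm (y (Suc k) - y k - V (t k) (y k) (g (t (Suc k)) - g (t k))) \<le> 1 * (t (Suc k) - t k)"
      using rem by simp
  qed
  then have "norm (y l - y k) \<le> growth_const T A R \<alpha> \<beta> * (1 + 1 + norm (y 0)) * (t l - t k) powr \<alpha>"
    by (rule young_recursion_holder) (use exps A_nonneg R_nonneg fine range kl in auto)
  then show ?thesis by simp
qed

text \<open>
  The integral over \<open>[0,0]\<close> vanishes because the one-point partition \<open>[0]\<close> belongs to every
  neighbourhood of mesh zero.
\<close>

lemma solution_initial:
  assumes "solution a x"
  shows "x 0 = a"
proof -
  obtain I where I: "has_young_integral (\<lambda>s. V s (x s)) g 0 0 I" "x 0 = a + I"
    using assms T_pos unfolding solution_def by force
  have "norm I \<le> e" if "0 < e" for e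
  proof -
    obtain \<delta> where "0 < \<delta>"
      "\<And>\<pi>. is_partition 0 0 \<pi> \<Longrightarrow> mesh \<pi> < \<delta> \<Longrightarrow> dist (young_sum (\<lambda>s. V s (x s)) g \<pi>) I < e"
      using tendstoD[OF I(1)[unfolded has_young_integral_def] \<open>0 < e\<close>]
      unfolding eventually_mesh_to_zero by blast
    from this(2)[of "[0]"] this(1) show ?thesis
      by (simp add: is_partition_def mesh_def young_sum_def)
  qed
  then have "norm I \<le> 0" by (rule field_le_epsilon[of _ 0, simplified])
  then show ?thesis using I(2) by simp
qed

lemma solution_remainder:
  assumes x: "solution a x" and N: "holder_bounded T \<alpha> N x" "0 \<le> N"
    and X: "\<And>r. r \<in> {0..T} \<Longrightarrow> norm (x r) \<le> X"
    and st: "0 \<le> s" "s \<le> t" "t \<le> T"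
  shows "norm (x t - x s - V s (x s) (g t - g s))
           \<le> young_const (\<alpha> + \<beta>) * (A * (N + 1 + 2 * X)) * R * (t - s) powr (\<alpha> + \<beta>)"
proof -
  have "0 \<le> X" using order_trans[OF norm_ge_zero X[of 0]] T_pos by simp
  have V_holder: "holder_bounded T \<alpha> (A * (N + 1 + 2 * X)) (\<lambda>s. V s (x s))"
    unfolding holder_bounded_def
  proof (intro allI impI, elim conjE)
    fix s t assume st: "0 \<le> s" "s \<le> t" "t \<le> T"
    have "norm (V t (x t) - V s (x s))
        \<le> A * (norm (x t - x s) + (1 + norm (x t) + norm (x s)) * (t - s) powr \<alpha>)"
      using st by (rule growth_lipschitzD[OF V_growth])
    also have "\<dots> \<le> A * (N * (t - s) powr \<alpha> + (1 + X + X) * (t - s) powr \<alpha>)"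
      using st A_nonneg holder_boundedD[OF N(1) st] X
      by (intro mult_left_mono add_mono mult_right_mono) auto
    finally show "norm (V t (x t) - V s (x s)) \<le> A * (N + 1 + 2 * X) * (t - s) powr \<alpha>"
      by (simp add: algebra_simps)
  qed
  obtain I where I: "has_young_integral (\<lambda>s. V s (x s)) g 0 s I" "x s = a + I"
    using x st unfolding solution_def by force
  obtain J where J: "has_young_integral (\<lambda>s. V s (x s)) g 0 t J" "x t = a + J"
    using x st unfolding solution_def by force
  have "norm (J - I - V s (x s) (g t - g s))
      \<le> young_const (\<alpha> + \<beta>) * (A * (N + 1 + 2 * X)) * R * (t - s) powr (\<alpha> + \<beta>)"
    using exps A_nonneg R_nonneg N \<open>0 \<le> X\<close>
    by (intro young_integral_increment[OF I(1) J(1) st V_holder g_holder]) auto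
  then show ?thesis by (simp add: I(2) J(2))
qed

text \<open>
  The constant depends only on the data, although nothing is known about the size of the Hoelder norm of
  \<open>x\<close> beyond its finiteness. That norm only enters the one-step remainder
  \<open>Q d powr (\<alpha> + \<beta>)\<close>, which is below the step length once the sampling grid is fine enough, and the
  estimate for perturbed Euler schemes is uniform in the grid.
\<close>

lemma solution_increment:
  assumes x: "solution a x" and st: "0 \<le> s" "s \<le> t" "t \<le> T"
  shows "norm (x t - x s) \<le> growth_const T A R \<alpha> \<beta> * (2 + norm (x s)) * (t - s) powr \<alpha>"
proof (cases "s = t")
  case False
  then have "s < t" using st by simp
  obtain N where N: "0 \<le> N" "holder_norm T \<alpha> x \<le> ennreal N"
    using x unfolding solution_def by (elim conjE holder_spaceE)
  define Q where "Q = young_const (\<alpha> + \<beta>) * (A * (N + 1 + 2 * N)) * R"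
  have "0 \<le> Q"
    using young_const_pos[of "\<alpha> + \<beta>"] exps A_nonneg R_nonneg N by (simp add: Q_def)
  have rem: "norm (x r' - x r - V r (x r) (g r' - g r)) \<le> Q * (r' - r) powr (\<alpha> + \<beta>)"
    if "0 \<le> r" "r \<le> r'" "r' \<le> T" for r r'
    unfolding Q_def using holder_norm_leD[OF N(2,1)] N(1) that
    by (intro solution_remainder[OF x]) auto
  define \<delta> where "\<delta> = min (step_size A R \<alpha> \<beta> / 2) ((1 / (Q + 1)) powr (1 / (\<alpha> + \<beta> - 1)))"
  have "0 < \<delta>" using step_size(1)[of \<alpha> \<beta> A R] exps A_nonneg R_nonneg \<open>0 \<le> Q\<close> by (simp add: \<delta>_def)
  have small: "Q * \<delta> powr (\<alpha> + \<beta> - 1) \<le> 1"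
  proof -
    have "\<delta> powr (\<alpha> + \<beta> - 1) \<le> ((1 / (Q + 1)) powr (1 / (\<alpha> + \<beta> - 1))) powr (\<alpha> + \<beta> - 1)"
      using \<open>0 < \<delta>\<close> exps by (intro powr_mono2) (auto simp: \<delta>_def)
    also have "\<dots> = 1 / (Q + 1)" using exps \<open>0 \<le> Q\<close> by (simp add: powr_powr)
    finally have "Q * \<delta> powr (\<alpha> + \<beta> - 1) \<le> Q * (1 / (Q + 1))"
      using \<open>0 \<le> Q\<close> by (rule mult_left_mono)
    also have "\<dots> \<le> 1" using \<open>0 \<le> Q\<close> by simp
    finally show ?thesis .
  qed
  obtain u :: "nat \<Rightarrow> real" and n where u: "0 < n" "u 0 = s" "u n = t"
    "\<And>k. k < n \<Longrightarrow> u k < u (Suc k)" "\<And>k. k < n \<Longrightarrow> u (Suc k) - u k \<le> \<delta>"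
    using exists_fine_grid[OF \<open>s < t\<close> \<open>0 < \<delta>\<close>] by metis
  note le = increasing_upto_le[of n u, OF u(4)]
  have "norm (x (u n) - x (u 0))
      \<le> growth_const T A R \<alpha> \<beta> * (2 + norm (x (u 0))) * (u n - u 0) powr \<alpha>"
  proof (rule perturbed_euler_holder[where n = n and y = "\<lambda>k. x (u k)"])
    fix k assume "k < n"
    show "u k < u (Suc k)" using u \<open>k < n\<close> by simp
    show "u (Suc k) - u k \<le> step_size A R \<alpha> \<beta> / 2"
      using u(5)[OF \<open>k < n\<close>] by (simp add: \<delta>_def)
    define d where "d = u (Suc k) - u k"
    have d: "0 < d" "d \<le> \<delta>" using u \<open>k < n\<close> by (auto simp: d_def)
    have "norm (x (u (Suc k)) - x (u k) - V (u k) (x (u k)) (g (u (Suc k)) - g (u k)))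
        \<le> Q * d powr (\<alpha> + \<beta>)"
      unfolding d_def using le[of 0 k] le[of "Suc k" n] u st \<open>k < n\<close> d
      by (intro rem) (auto simp: less_imp_le)
    also have "\<dots> = Q * d powr (\<alpha> + \<beta> - 1) * d"
      using d by (simp add: powr_diff)
    also have "\<dots> \<le> Q * \<delta> powr (\<alpha> + \<beta> - 1) * d"
      using d exps \<open>0 \<le> Q\<close> by (intro mult_right_mono mult_left_mono powr_mono2) auto
    also have "\<dots> \<le> 1 * d" using small d by (intro mult_right_mono) auto
    finally show "norm (x (u (Suc k)) - x (u k) - V (u k) (x (u k)) (g (u (Suc k)) - g (u k)))
        \<le> u (Suc k) - u k"
      by (simp add: d_def)
  qed (use u st in auto)
  then show ?thesis by (simp add: u)
qed simp

lemma apriori_sup_ge: "0 \<le> \<rho> \<Longrightarrow> \<rho> \<le> apriori_sup T A R \<alpha> \<beta> \<rho>"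
  by (simp add: apriori_sup_def growth_const_nonneg)

lemma apriori_holder_nonneg: "0 \<le> \<rho> \<Longrightarrow> 0 \<le> apriori_holder T A R \<alpha> \<beta> \<rho>"
  using apriori_sup_ge[of \<rho>] by (simp add: apriori_holder_def growth_const_nonneg)

lemma solution_sup:
  assumes "solution a x" "norm a \<le> \<rho>" "t \<in> {0..T}"
  shows "norm (x t) \<le> apriori_sup T A R \<alpha> \<beta> \<rho>"
proof -
  have "norm (x t - x 0) \<le> growth_const T A R \<alpha> \<beta> * (2 + norm (x 0)) * (t - 0) powr \<alpha>"
    using assms by (intro solution_increment) auto
  also have "\<dots> \<le> growth_const T A R \<alpha> \<beta> * (2 + \<rho>) * T powr \<alpha>"
    using assms exps growth_const_nonneg order_trans[OF norm_ge_zero assms(2)]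
    by (intro mult_mono powr_mono2 mult_nonneg_nonneg) (auto simp: solution_initial[OF assms(1)])
  finally show ?thesis
    using norm_triangle_ineq[of "x t - x 0" "x 0"] assms
    by (simp add: apriori_sup_def solution_initial[OF assms(1)])
qed

lemma solution_holder:
  assumes "solution a x" "norm a \<le> \<rho>"
  shows "holder_bounded T \<alpha> (apriori_holder T A R \<alpha> \<beta> \<rho>) x"
  unfolding holder_bounded_def
proof (intro allI impI)
  fix s t assume st: "0 \<le> s \<and> s \<le> t \<and> t \<le> T"
  have "norm (x t - x s) \<le> growth_const T A R \<alpha> \<beta> * (2 + norm (x s)) * (t - s) powr \<alpha>"
    using st by (intro solution_increment[OF assms(1)]) auto
  also have "\<dots> \<le> apriori_holder T A R \<alpha> \<beta> \<rho> * (t - s) powr \<alpha>"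
    unfolding apriori_holder_def using solution_sup[OF assms, of s] st growth_const_nonneg
    by (intro mult_right_mono mult_left_mono) auto
  finally show "norm (x t - x s) \<le> apriori_holder T A R \<alpha> \<beta> \<rho> * (t - s) powr \<alpha>" .
qed

lemma euler_apriori:
  assumes incr: "\<And>k. k < n \<Longrightarrow> t k < t (Suc k)" and range: "t 0 = 0" "t n = T"
    and fine: "\<And>k. k < n \<Longrightarrow> t (Suc k) - t k \<le> step_size A R \<alpha> \<beta> / 2"
    and y: "\<And>k. k < n \<Longrightarrow> y (Suc k) = y k + V (t k) (y k) (g (t (Suc k)) - g (t k))"
    and \<rho>: "norm (y 0) \<le> \<rho>"
  shows "l \<le> n \<Longrightarrow> norm (y l) \<le> apriori_sup T A R \<alpha> \<beta> \<rho>"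
    and "k \<le> l \<Longrightarrow> l \<le> n \<Longrightarrow> norm (y l - y k) \<le> apriori_holder T A R \<alpha> \<beta> \<rho> * (t l - t k) powr \<alpha>"
proof -
  note le = increasing_upto_le[of n t, OF incr]
  have "0 \<le> \<rho>" using \<rho> norm_ge_zero order_trans by blast
  have incr_le: "norm (y l - y k) \<le> growth_const T A R \<alpha> \<beta> * (2 + \<rho>) * (t l - t k) powr \<alpha>"
    if "k \<le> l" "l \<le> n" for k l
  proof -
    have "norm (y l - y k) \<le> growth_const T A R \<alpha> \<beta> * (2 + norm (y 0)) * (t l - t k) powr \<alpha>"
      using incr fine y range that by (intro perturbed_euler_holder) (auto simp: less_imp_le)
    also have "\<dots> \<le> growth_const T A R \<alpha> \<beta> * (2 + \<rho>) * (t l - t k) powr \<alpha>"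
      using \<rho> growth_const_nonneg by (intro mult_right_mono mult_left_mono) auto
    finally show ?thesis .
  qed
  show "norm (y l) \<le> apriori_sup T A R \<alpha> \<beta> \<rho>" if "l \<le> n" for l
  proof -
    have "norm (y l - y 0) \<le> growth_const T A R \<alpha> \<beta> * (2 + \<rho>) * (t l - t 0) powr \<alpha>"
      using incr_le that by simp
    also have "\<dots> \<le> growth_const T A R \<alpha> \<beta> * (2 + \<rho>) * T powr \<alpha>"
      using that le[of 0 l] le[of l n] range exps \<open>0 \<le> \<rho>\<close> growth_const_nonneg
      by (intro mult_left_mono powr_mono2) auto
    finally show ?thesis
      using norm_triangle_ineq[of "y l - y 0" "y 0"] \<rho> by (simp add: apriori_sup_def)
  qed
  show "norm (y l - y k) \<le> apriori_holder T A R \<alpha> \<beta> \<rho> * (t l - t k) powr \<alpha>"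
    if "k \<le> l" "l \<le> n"
  proof -
    have "growth_const T A R \<alpha> \<beta> * (2 + \<rho>) \<le> apriori_holder T A R \<alpha> \<beta> \<rho>"
      unfolding apriori_holder_def using growth_const_nonneg apriori_sup_ge[OF \<open>0 \<le> \<rho>\<close>]
      by (intro mult_left_mono) auto
    then show ?thesis
      using incr_le[OF that] by (meson mult_right_mono order_trans powr_ge_zero)
  qed
qed

end

section \<open>The error at the grid points\<close>

text \<open>
  The constants of the error analysis: \<open>remainder_const\<close> bounds the one-step error of the exact
  solution relative to \<open>d powr (\<alpha> + \<beta>)\<close>, and \<open>error_growth\<close> plays for the difference of solution
  and scheme the part that \<open>A\<close> plays for each of them.
\<close>

definition remainder_const :: "real \<Rightarrow> real \<Rightarrow> real \<Rightarrow> real \<Rightarrow> real \<Rightarrow> real \<Rightarrow> real" where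
  "remainder_const T A R \<alpha> \<beta> \<rho> = young_const (\<alpha> + \<beta>) *
     (A * (apriori_holder T A R \<alpha> \<beta> \<rho> + 1 + 2 * apriori_sup T A R \<alpha> \<beta> \<rho>)) * R"

definition error_growth :: "real \<Rightarrow> real \<Rightarrow> real \<Rightarrow> real \<Rightarrow> real \<Rightarrow> real \<Rightarrow> real" where
  "error_growth T A R \<alpha> \<beta> \<rho> =
     A * (apriori_holder T A R \<alpha> \<beta> \<rho> + 1 + 4 * apriori_sup T A R \<alpha> \<beta> \<rho>)"

definition euler_step :: "real \<Rightarrow> real \<Rightarrow> real \<Rightarrow> real \<Rightarrow> real \<Rightarrow> real \<Rightarrow> real" where
  "euler_step T A R \<alpha> \<beta> \<rho> =
     min (step_size A R \<alpha> \<beta>) (step_size (error_growth T A R \<alpha> \<beta> \<rho>) R \<alpha> \<beta>) / 2"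

definition grid_error_const :: "real \<Rightarrow> real \<Rightarrow> real \<Rightarrow> real \<Rightarrow> real \<Rightarrow> real \<Rightarrow> real" where
  "grid_error_const T A R \<alpha> \<beta> \<rho> =
     growth_const T (error_growth T A R \<alpha> \<beta> \<rho>) R \<alpha> \<beta> * remainder_const T A R \<alpha> \<beta> \<rho> * T powr \<alpha>"

context young_equation
begin

text \<open>
  This is where the differentiability of the coefficients enters. With \<open>z = x - y\<close> and \<open>z' = x' - y'\<close>,
  the increment of \<open>V x - V y\<close> splits into a second-order increment along the common direction \<open>z'\<close>,
  controlled by the regularity of \<open>D\<close>, and the difference \<open>V s (y + z') - V s (y + z)\<close>,
  controlled by the Lipschitz bound of \<open>V s\<close>. Both are linear in the differences, so the error again solves a
  Young recursion.
\<close>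

lemma coefficient_difference_increment:
  assumes st: "0 \<le> s" "s \<le> t" "t \<le> T" and "0 \<le> N"
    and y: "norm (y' - y) \<le> N * (t - s) powr \<alpha>"
    and X: "norm x \<le> X" "norm x' \<le> X" "norm y \<le> X" "norm y' \<le> X"
  shows "norm ((V t x' - V t y') - (V s x - V s y))
    \<le> A * (N + 1 + 4 * X)
        * (norm ((x' - y') - (x - y)) + (norm (x - y) + norm (x' - y')) * (t - s) powr \<alpha>)"
proof -
  define z z' where "z = x - y" and "z' = x' - y'"
  let ?d = "(t - s) powr \<alpha>"
  have "0 \<le> X" using X(1) norm_ge_zero order_trans by blast
  have "norm ((V t (y' + z') - V t y') - (V s (y + z') - V s y)) \<le> A * (N + 1 + 4 * X) * ?d * norm z'"
  proof (rule double_increment_bound[OF V_deriv V_deriv])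
    fix r :: real assume r: "0 \<le> r" "r \<le> 1"
    have "norm (y' + r *\<^sub>R z') = norm ((1 - r) *\<^sub>R y' + r *\<^sub>R x')"
      by (simp add: z'_def algebra_simps)
    also have "\<dots> \<le> (1 - r) * X + r * X"
      using r X by (intro norm_triangle_le add_mono) (auto intro!: mult_left_mono)
    finally have 1: "norm (y' + r *\<^sub>R z') \<le> X" by (simp add: algebra_simps)
    have "norm z' \<le> 2 * X" using norm_triangle_ineq4[of x' y'] X by (simp add: z'_def)
    moreover have "norm (r *\<^sub>R z') \<le> 1 * norm z'" using r by (simp add: mult_left_le_one_le)
    ultimately have 2: "norm (y + r *\<^sub>R z') \<le> 3 * X"
      using norm_triangle_ineq[of y "r *\<^sub>R z'"] X by simp
    have "norm (D t (y' + r *\<^sub>R z') - D s (y + r *\<^sub>R z'))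
        \<le> A * (norm ((y' + r *\<^sub>R z') - (y + r *\<^sub>R z'))
            + (1 + norm (y' + r *\<^sub>R z') + norm (y + r *\<^sub>R z')) * ?d)"
      using st by (rule growth_lipschitzD[OF D_growth])
    also have "\<dots> \<le> A * (N * ?d + (1 + X + 3 * X) * ?d)"
      using 1 2 y A_nonneg by (intro mult_left_mono add_mono mult_right_mono) auto
    finally show "norm (D t (y' + r *\<^sub>R z') - D s (y + r *\<^sub>R z')) \<le> A * (N + 1 + 4 * X) * ?d"
      by (simp add: algebra_simps)
  qed
  moreover have "norm (V s (y + z') - V s (y + z)) \<le> A * norm (z' - z)"
    using growth_lipschitzD[OF V_growth, of s s "y + z'" "y + z"] st by simp
  moreover have "(V t x' - V t y') - (V s x - V s y)
      = ((V t (y' + z') - V t y') - (V s (y + z') - V s y)) + (V s (y + z') - V s (y + z))"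
    by (simp add: z_def z'_def)
  ultimately have "norm ((V t x' - V t y') - (V s x - V s y))
      \<le> A * (N + 1 + 4 * X) * ?d * norm z' + A * norm (z' - z)"
    by (metis (no_types, lifting) add_mono norm_triangle_le)
  also have "\<dots> \<le> A * (N + 1 + 4 * X) * ?d * (norm z + norm z') + A * (N + 1 + 4 * X) * norm (z' - z)"
    using A_nonneg \<open>0 \<le> X\<close> \<open>0 \<le> N\<close> mult_left_mono[of 1 "N + 1 + 4 * X" A]
    by (intro add_mono mult_left_mono mult_right_mono) auto
  finally show ?thesis by (simp add: z_def z'_def algebra_simps)
qed

text \<open>
  The difference \<open>z\<close> of solution and scheme satisfies a Young recursion with \<open>b = 0\<close> and \<open>z 0 = 0\<close>,
  driven by the one-step remainder of the solution. On a cell of length \<open>d \<le> \<delta>\<close> this remainder is at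
  most \<open>Q d powr (\<alpha> + \<beta>) \<le> Q \<delta> powr (\<alpha> + \<beta> - 1) d\<close>, which gives the rate.
\<close>

lemma euler_grid_error:
  assumes x: "solution a x" and \<rho>: "norm a \<le> \<rho>"
    and incr: "\<And>k. k < n \<Longrightarrow> t k < t (Suc k)" and range: "t 0 = 0" "t n = T"
    and fine: "\<And>k. k < n \<Longrightarrow> t (Suc k) - t k \<le> \<delta>" "\<delta> \<le> euler_step T A R \<alpha> \<beta> \<rho>" "0 \<le> \<delta>"
    and y: "y 0 = a" "\<And>k. k < n \<Longrightarrow> y (Suc k) = y k + V (t k) (y k) (g (t (Suc k)) - g (t k))"
    and "l \<le> n"
  shows "norm (x (t l) - y l) \<le> grid_error_const T A R \<alpha> \<beta> \<rho> * \<delta> powr (\<alpha> + \<beta> - 1)"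
proof -
  define X N Q A' where "X = apriori_sup T A R \<alpha> \<beta> \<rho>" and "N = apriori_holder T A R \<alpha> \<beta> \<rho>"
    and "Q = remainder_const T A R \<alpha> \<beta> \<rho>" and "A' = error_growth T A R \<alpha> \<beta> \<rho>"
  have "0 \<le> \<rho>" using \<rho> norm_ge_zero order_trans by blast
  have "0 \<le> X" "0 \<le> N"
    using apriori_sup_ge[OF \<open>0 \<le> \<rho>\<close>] apriori_holder_nonneg[OF \<open>0 \<le> \<rho>\<close>] \<open>0 \<le> \<rho>\<close>
    by (auto simp: X_def N_def)
  have A': "A' = A * (N + 1 + 4 * X)" by (simp add: A'_def error_growth_def X_def N_def)
  have "A * 1 \<le> A'"
    unfolding A' using A_nonneg \<open>0 \<le> X\<close> \<open>0 \<le> N\<close> by (intro mult_left_mono) auto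
  then have "A \<le> A'" by simp
  have "0 \<le> Q"
    using young_const_pos[of "\<alpha> + \<beta>"] exps A_nonneg R_nonneg \<open>0 \<le> X\<close> \<open>0 \<le> N\<close>
    by (simp add: Q_def remainder_const_def X_def N_def)
  note le = increasing_upto_le[of n t, OF incr]
  have bounds: "0 \<le> t k" "t k \<le> T" if "k \<le> n" for k
    using le[of 0 k] le[of k n] range that by auto
  have half_steps: "t (Suc k) - t k \<le> step_size A R \<alpha> \<beta> / 2" "t (Suc k) - t k \<le> step_size A' R \<alpha> \<beta> / 2"
    if "k < n" for k
    using fine(1)[OF that] fine(2) by (auto simp: euler_step_def A'_def)
  have y_sup: "norm (y k) \<le> X" if "k \<le> n" for k
    unfolding X_def using that incr range half_steps y \<rho> by (intro euler_apriori(1)[of n t y]) auto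
  have y_holder: "norm (y l - y k) \<le> N * (t l - t k) powr \<alpha>" if "k \<le> l" "l \<le> n" for k l
    unfolding N_def using that incr range half_steps y \<rho> by (intro euler_apriori(2)[of n t y]) auto
  have x_sup: "norm (x r) \<le> X" if "r \<in> {0..T}" for r
    unfolding X_def using solution_sup[OF x \<rho> that] .
  let ?\<epsilon> = "Q * \<delta> powr (\<alpha> + \<beta> - 1)"
  let ?z = "\<lambda>k. x (t k) - y k"
  have "young_recursion A' R \<alpha> \<beta> n t (\<lambda>k. g (t k)) (\<lambda>k. V (t k) (x (t k)) - V (t k) (y k)) ?z 0 ?\<epsilon>"
    unfolding young_recursion_def
  proof (intro conjI allI impI)
    fix k l assume "k < l \<and> l \<le> n"
    then show "t k < t l" using increasing_upto[of n t] incr by auto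
  next
    fix k l assume kl: "k \<le> l \<and> l \<le> n"
    then have tkl: "0 \<le> t k" "t k \<le> t l" "t l \<le> T" using bounds le by auto
    then show "norm (g (t l) - g (t k)) \<le> R * (t l - t k) powr \<beta>"
      by (rule holder_boundedD[OF g_holder])
    have "norm ((V (t l) (x (t l)) - V (t l) (y l)) - (V (t k) (x (t k)) - V (t k) (y k)))
        \<le> A * (N + 1 + 4 * X)
            * (norm (?z l - ?z k) + (norm (?z k) + norm (?z l)) * (t l - t k) powr \<alpha>)"
      using kl tkl \<open>0 \<le> N\<close> y_holder y_sup x_sup by (intro coefficient_difference_increment) auto
    then show "norm ((V (t l) (x (t l)) - V (t l) (y l)) - (V (t k) (x (t k)) - V (t k) (y k)))
        \<le> A' * (norm (?z l - ?z k) + (0 + norm (?z k) + norm (?z l)) * (t l - t k) powr \<alpha>)"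
      by (simp add: A')
  next
    fix k assume "k \<le> n"
    then have "norm (V (t k) (x (t k)) - V (t k) (y k)) \<le> A * norm (?z k)"
      using growth_lipschitzD[OF V_growth, of "t k" "t k"] bounds by simp
    also have "\<dots> \<le> A' * norm (?z k)" using \<open>A \<le> A'\<close> by (rule mult_right_mono) simp
    finally show "norm (V (t k) (x (t k)) - V (t k) (y k)) \<le> A' * (0 + norm (?z k))" by simp
  next
    fix k assume "k < n"
    define d where "d = t (Suc k) - t k"
    have d: "0 < d" "d \<le> \<delta>" using incr fine \<open>k < n\<close> by (auto simp: d_def)
    have eq: "?z (Suc k) - ?z k - (V (t k) (x (t k)) - V (t k) (y k)) (g (t (Suc k)) - g (t k))
        = x (t (Suc k)) - x (t k) - V (t k) (x (t k)) (g (t (Suc k)) - g (t k))"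
      using y(2)[OF \<open>k < n\<close>] by (simp add: blinfun.diff_left)
    have "norm (?z (Suc k) - ?z k - (V (t k) (x (t k)) - V (t k) (y k)) (g (t (Suc k)) - g (t k)))
        \<le> Q * d powr (\<alpha> + \<beta>)"
      unfolding eq Q_def remainder_const_def d_def
      using \<open>k < n\<close> bounds[of k] bounds[of "Suc k"] incr[OF \<open>k < n\<close>] \<open>0 \<le> N\<close> x_sup
      by (intro solution_remainder[OF x solution_holder[OF x \<rho>]]) (auto simp: N_def X_def)
    also have "\<dots> = Q * d powr (\<alpha> + \<beta> - 1) * d"
      using d by (simp add: powr_diff)
    also have "\<dots> \<le> ?\<epsilon> * d"
      using d exps \<open>0 \<le> Q\<close> by (intro mult_right_mono mult_left_mono powr_mono2) auto
    finally show "norm (?z (Suc k) - ?z k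
          - (V (t k) (x (t k)) - V (t k) (y k)) (g (t (Suc k)) - g (t k)))
        \<le> ?\<epsilon> * (t (Suc k) - t k)"
      by (simp only: d_def)
  qed
  then have "norm (?z l - ?z 0)
      \<le> growth_const T A' R \<alpha> \<beta> * (0 + ?\<epsilon> + norm (?z 0)) * (t l - t 0) powr \<alpha>"
    by (rule young_recursion_holder)
       (use exps \<open>A \<le> A'\<close> A_nonneg R_nonneg \<open>0 \<le> Q\<close> half_steps range \<open>l \<le> n\<close> in auto)
  also have "\<dots> \<le> growth_const T A' R \<alpha> \<beta> * (0 + ?\<epsilon> + norm (?z 0)) * T powr \<alpha>"
    using bounds[OF \<open>l \<le> n\<close>] range exps \<open>0 \<le> Q\<close> growth_const_nonneg
    by (intro mult_left_mono powr_mono2) auto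
  finally show ?thesis
    using solution_initial[OF x] y(1) range
    by (simp add: grid_error_const_def Q_def A'_def mult_ac)
qed

end

section \<open>From the grid to the interpolation\<close>

lemma exists_grid_cell:
  fixes t :: "nat \<Rightarrow> real"
  assumes "0 < n" "t 0 \<le> r" "r \<le> t n"
  obtains k where "k < n" "t k \<le> r" "r \<le> t (Suc k)"
proof -
  have "\<exists>k<n. t k \<le> r \<and> r \<le> t (Suc k)"
    using assms
  proof (induction n)
    case (Suc n)
    then show ?case
      by (cases "n = 0"; cases "t n \<le> r") (auto intro: less_SucI)
  qed simp
  then show thesis using that by blast
qed

text \<open>
  Within a cell, an increment of \<open>f\<close> is a fraction \<open>c \<in> [0,1]\<close> of the increment of \<open>y\<close>, and
  \<open>c \<le> c powr \<alpha>\<close> because \<open>\<alpha> \<le> 1\<close>. Across cells, an increment splits into two partial cells and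
  one increment between grid points, whence the factor 3.
\<close>

lemma piecewise_linear_holder:
  fixes y :: "nat \<Rightarrow> 'a::real_normed_vector" and f :: "real \<Rightarrow> 'a"
  assumes incr: "\<And>k. k < n \<Longrightarrow> t k < t (Suc k)" and range: "t 0 = 0" "t n = T" "0 < n"
    and y: "\<And>k l. k \<le> l \<Longrightarrow> l \<le> n \<Longrightarrow> norm (y l - y k) \<le> N * (t l - t k) powr \<alpha>"
    and f: "\<And>k r. k < n \<Longrightarrow> t k \<le> r \<Longrightarrow> r \<le> t (Suc k) \<Longrightarrow>
      f r = y k + ((r - t k) / (t (Suc k) - t k)) *\<^sub>R (y (Suc k) - y k)"
    and \<alpha>: "0 < \<alpha>" "\<alpha> \<le> 1" and "0 \<le> N"
  shows "holder_bounded T \<alpha> (3 * N) f"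
proof -
  have cell: "norm (f r - f s) \<le> N * (r - s) powr \<alpha>"
    if "k < n" "t k \<le> s" "s \<le> r" "r \<le> t (Suc k)" for k r s
  proof -
    define d c where "d = t (Suc k) - t k" and "c = (r - s) / d"
    have "0 < d" using incr that by (simp add: d_def)
    have c: "0 \<le> c" "c \<le> 1" using that \<open>0 < d\<close> by (auto simp: c_def d_def)
    have "f r = y k + ((r - t k) / d) *\<^sub>R (y (Suc k) - y k)"
      "f s = y k + ((s - t k) / d) *\<^sub>R (y (Suc k) - y k)"
      unfolding d_def using that by (auto intro!: f)
    then have "f r - f s = c *\<^sub>R (y (Suc k) - y k)"
      by (simp add: c_def diff_divide_distrib flip: scaleR_diff_left)
    then have "norm (f r - f s) = c * norm (y (Suc k) - y k)" using c by simp
    also have "\<dots> \<le> c powr \<alpha> * (N * d powr \<alpha>)"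
    proof (rule mult_mono)
      show "c \<le> c powr \<alpha>" using powr_mono'[of \<alpha> 1 c] c \<alpha> by simp
      show "norm (y (Suc k) - y k) \<le> N * d powr \<alpha>" using y[of k "Suc k"] that by (simp add: d_def)
    qed auto
    also have "\<dots> = N * (c * d) powr \<alpha>" using c \<open>0 < d\<close> by (simp add: powr_mult)
    also have "c * d = r - s" using \<open>0 < d\<close> by (simp add: c_def)
    finally show ?thesis .
  qed
  show ?thesis
    unfolding holder_bounded_def
  proof (intro allI impI, elim conjE)
    fix s r assume sr: "0 \<le> s" "s \<le> r" "r \<le> T"
    obtain k where k: "k < n" "t k \<le> s" "s \<le> t (Suc k)"
      using exists_grid_cell[of n t s] range sr by auto
    obtain l where l: "l < n" "t l \<le> r" "r \<le> t (Suc l)"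
      using exists_grid_cell[of n t r] range sr by auto
    note le = increasing_upto_le[of n t, OF incr]
    show "norm (f r - f s) \<le> 3 * N * (r - s) powr \<alpha>"
    proof (cases "r \<le> t (Suc k)")
      case True
      have "norm (f r - f s) \<le> N * (r - s) powr \<alpha>" using cell[of k s r] k sr True by simp
      also have "\<dots> \<le> 3 * N * (r - s) powr \<alpha>" using \<open>0 \<le> N\<close> by (intro mult_right_mono) auto
      finally show ?thesis .
    next
      case False
      then have "k < l" using l le[of "Suc l" "Suc k"] k by (cases "k < l") auto
      have tkl: "t (Suc k) \<le> t l" using \<open>k < l\<close> l le[of "Suc k" l] by simp
      have f_grid: "f (t (Suc k)) = y (Suc k)" "f (t l) = y l"
        using f[of k "t (Suc k)"] f[of l "t l"] incr[of k] incr[of l] k l by auto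
      have mono: "N * c powr \<alpha> \<le> N * (r - s) powr \<alpha>" if "0 \<le> c" "c \<le> r - s" for c
        using that \<alpha> \<open>0 \<le> N\<close> by (intro mult_left_mono powr_mono2) auto
      have "norm (f (t (Suc k)) - f s) \<le> N * (r - s) powr \<alpha>"
        using order_trans[OF cell[of k s "t (Suc k)"] mono] k l tkl by simp
      moreover have "norm (f (t l) - f (t (Suc k))) \<le> N * (r - s) powr \<alpha>"
        unfolding f_grid using order_trans[OF y[of "Suc k" l] mono] \<open>k < l\<close> k l tkl by simp
      moreover have "norm (f r - f (t l)) \<le> N * (r - s) powr \<alpha>"
        using order_trans[OF cell[of l "t l" r] mono] k l tkl by simp
      moreover have "norm (f r - f s) \<le> norm (f (t (Suc k)) - f s)
          + norm (f (t l) - f (t (Suc k))) + norm (f r - f (t l))"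
        using norm_triangle_ineq[of "f (t (Suc k)) - f s" "f (t l) - f (t (Suc k))"]
          norm_triangle_ineq[of "f (t l) - f s" "f r - f (t l)"] by simp
      ultimately show ?thesis by simp
    qed
  qed
qed

text \<open>
  The geometric mean, with weights \<open>\<alpha>' / \<alpha>\<close> and \<open>1 - \<alpha>' / \<alpha>\<close>, of the Hoelder bound on an
  increment and the trivial bound \<open>2 B\<close>.
\<close>

lemma holder_interpolation:
  assumes f: "holder_bounded T \<alpha> L f" "\<And>t. t \<in> {0..T} \<Longrightarrow> norm (f t) \<le> B"
    and \<alpha>: "0 < \<alpha>'" "\<alpha>' < \<alpha>" and "0 \<le> L"
  shows "holder_bounded T \<alpha>' (L powr (\<alpha>' / \<alpha>) * (2 * B) powr (1 - \<alpha>' / \<alpha>)) f"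
  unfolding holder_bounded_def
proof (intro allI impI, elim conjE)
  fix s t assume st: "0 \<le> s" "s \<le> t" "t \<le> T"
  define u q where "u = norm (f t - f s)" and "q = \<alpha>' / \<alpha>"
  have q: "0 < q" "q < 1" using \<alpha> by (auto simp: q_def)
  have "u \<le> L * (t - s) powr \<alpha>" using holder_boundedD[OF f(1) st] by (simp add: u_def)
  have "u \<le> 2 * B" unfolding u_def
    using norm_triangle_ineq4[of "f t" "f s"] f(2)[of s] f(2)[of t] st by simp
  have "u = u powr q * u powr (1 - q)" by (simp add: u_def flip: powr_add)
  also have "\<dots> \<le> (L * (t - s) powr \<alpha>) powr q * (2 * B) powr (1 - q)"
    using q \<open>u \<le> L * (t - s) powr \<alpha>\<close> \<open>u \<le> 2 * B\<close>
    by (intro mult_mono powr_mono2) (auto simp: u_def)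
  also have "\<dots> = L powr q * (2 * B) powr (1 - q) * (t - s) powr \<alpha>'"
    using \<alpha> \<open>0 \<le> L\<close> by (simp add: powr_mult powr_powr q_def)
  finally show "norm (f t - f s) \<le> L powr (\<alpha>' / \<alpha>) * (2 * B) powr (1 - \<alpha>' / \<alpha>) * (t - s) powr \<alpha>'"
    by (simp add: u_def q_def)
qed

text \<open>
  On the closed cell: at the right end point the scheme is read off from the next cell, or from the
  separate clause for the last point, and both agree with the formula of this cell.
\<close>

lemma euler_interp_cell:
  assumes \<pi>: "is_partition a b \<pi>" and k: "Suc k < length \<pi>" "\<pi> ! k \<le> r" "r \<le> \<pi> ! Suc k"
  shows "euler_interp \<sigma> w g x\<^sub>0 \<pi> r = euler \<sigma> w g x\<^sub>0 \<pi> k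
    + ((r - \<pi> ! k) / (\<pi> ! Suc k - \<pi> ! k)) *\<^sub>R (euler \<sigma> w g x\<^sub>0 \<pi> (Suc k) - euler \<sigma> w g x\<^sub>0 \<pi> k)"
    (is "_ = ?rhs k")
proof -
  have incr: "\<pi> ! i < \<pi> ! j" if "i < j" "j < length \<pi>" for i j
    using \<pi> that by (auto simp: is_partition_def sorted_wrt_iff_nth_less)
  have le: "\<pi> ! i \<le> \<pi> ! j" if "i \<le> j" "j < length \<pi>" for i j
    using incr[of i j] that by (cases "i = j") auto
  have last: "last \<pi> = \<pi> ! (length \<pi> - 1)"
    using \<pi> unfolding is_partition_def by (intro last_conv_nth) simp
  have half_open: "euler_interp \<sigma> w g x\<^sub>0 \<pi> r = ?rhs j"
    if j: "Suc j < length \<pi>" "\<pi> ! j \<le> r" "r < \<pi> ! Suc j" for j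
  proof -
    have "(THE i. Suc i < length \<pi> \<and> r \<in> {\<pi> ! i..<\<pi> ! Suc i}) = j"
    proof (rule the_equality)
      fix i assume i: "Suc i < length \<pi> \<and> r \<in> {\<pi> ! i..<\<pi> ! Suc i}"
      then have "\<not> i < j" "\<not> j < i"
        using le[of "Suc i" j] le[of "Suc j" i] j by auto
      then show "i = j" by simp
    qed (use j in auto)
    moreover have "\<pi> ! Suc j \<le> last \<pi>" unfolding last using j by (intro le) auto
    then have "r \<noteq> last \<pi>" using j by auto
    ultimately show ?thesis by (simp add: euler_interp_def Let_def)
  qed
  show ?thesis
  proof (cases "r = \<pi> ! Suc k")
    case False
    then show ?thesis using half_open k by simp
  next
    case True
    then have rhs: "?rhs k = euler \<sigma> w g x\<^sub>0 \<pi> (Suc k)"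
      using incr[of k "Suc k"] k by simp
    show ?thesis
    proof (cases "Suc (Suc k) < length \<pi>")
      case True
      then show ?thesis
        using half_open[of "Suc k"] incr[of "Suc k" "Suc (Suc k)"] \<open>r = \<pi> ! Suc k\<close> unfolding rhs by simp
    next
      case False
      then have "length \<pi> - 1 = Suc k" using k by simp
      then show ?thesis
        unfolding rhs using last \<open>r = \<pi> ! Suc k\<close> by (simp add: euler_interp_def)
    qed
  qed
qed

section \<open>The convergence rate\<close>

definition sup_error_const :: "real \<Rightarrow> real \<Rightarrow> real \<Rightarrow> real \<Rightarrow> real \<Rightarrow> real \<Rightarrow> real" where
  "sup_error_const T A R \<alpha> \<beta> \<rho> =
     2 * apriori_holder T A R \<alpha> \<beta> \<rho> + grid_error_const T A R \<alpha> \<beta> \<rho>"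

definition euler_const :: "real \<Rightarrow> real \<Rightarrow> real \<Rightarrow> real \<Rightarrow> real \<Rightarrow> real \<Rightarrow> real" where
  "euler_const T A R \<alpha> \<beta> \<rho> = sup_error_const T A R \<alpha> \<beta> \<rho>
     + (4 * apriori_holder T A R \<alpha> \<beta> \<rho> + 1) * (2 * sup_error_const T A R \<alpha> \<beta> \<rho> + 1)"

context young_equation
begin

lemma grid_error_const_nonneg:
  assumes "0 \<le> \<rho>"
  shows "0 \<le> grid_error_const T A R \<alpha> \<beta> \<rho>"
  using young_const_pos[of "\<alpha> + \<beta>"] exps A_nonneg R_nonneg
    apriori_sup_ge[OF assms] apriori_holder_nonneg[OF assms] assms
  by (simp add: grid_error_const_def remainder_const_def growth_const_nonneg)

lemma euler_const_pos:
  assumes "0 \<le> \<rho>"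
  shows "0 < euler_const T A R \<alpha> \<beta> \<rho>"
  using grid_error_const_nonneg[OF assms] apriori_holder_nonneg[OF assms]
  by (simp add: euler_const_def sup_error_const_def add_nonneg_pos)

lemma euler_step_pos:
  assumes "0 \<le> \<rho>"
  shows "0 < euler_step T A R \<alpha> \<beta> \<rho>"
proof -
  have "0 \<le> error_growth T A R \<alpha> \<beta> \<rho>"
    using A_nonneg apriori_sup_ge[OF assms] apriori_holder_nonneg[OF assms] assms
    by (simp add: error_growth_def)
  then show ?thesis
    using step_size(1)[of \<alpha> \<beta> A R] step_size(1)[of \<alpha> \<beta> "error_growth T A R \<alpha> \<beta> \<rho>" R]
      exps A_nonneg R_nonneg
    by (simp add: euler_step_def)
qed

text \<open>
  At a time in a cell, the error is the error at the left grid point plus the oscillations of the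
  interpolation and of the solution on the cell. The oscillations are of order
  \<open>\<delta> powr \<alpha>\<close>, which is at most \<open>\<delta> powr (\<alpha> + \<beta> - 1)\<close> since \<open>\<beta> \<le> 1\<close> and \<open>\<delta> \<le> 1\<close>. Interpolating this
  sup bound with the bounded \<open>\<alpha>\<close>-Hoelder seminorm of the error produces the exponent
  \<open>(1 - \<alpha>' / \<alpha>) (\<alpha> + \<beta> - 1)\<close>.
\<close>

lemma interpolated_euler_error:
  assumes x: "solution a x" and \<rho>: "norm a \<le> \<rho>"
    and incr: "\<And>k. k < n \<Longrightarrow> t k < t (Suc k)" and range: "t 0 = 0" "t n = T"
    and fine: "\<And>k. k < n \<Longrightarrow> t (Suc k) - t k \<le> \<delta>" "\<delta> \<le> euler_step T A R \<alpha> \<beta> \<rho>" "0 \<le> \<delta>" "\<delta> \<le> 1"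
    and y: "y 0 = a" "\<And>k. k < n \<Longrightarrow> y (Suc k) = y k + V (t k) (y k) (g (t (Suc k)) - g (t k))"
    and f: "\<And>k r. k < n \<Longrightarrow> t k \<le> r \<Longrightarrow> r \<le> t (Suc k) \<Longrightarrow>
      f r = y k + ((r - t k) / (t (Suc k) - t k)) *\<^sub>R (y (Suc k) - y k)"
    and \<alpha>': "0 < \<alpha>'" "\<alpha>' < \<alpha>"
  shows "holder_norm T \<alpha>' (\<lambda>r. f r - x r)
    \<le> ennreal (euler_const T A R \<alpha> \<beta> \<rho> * \<delta> powr ((1 - \<alpha>' / \<alpha>) * (\<alpha> + \<beta> - 1)))"
proof -
  define N G E where "N = apriori_holder T A R \<alpha> \<beta> \<rho>" and "G = grid_error_const T A R \<alpha> \<beta> \<rho>"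
    and "E = sup_error_const T A R \<alpha> \<beta> \<rho>"
  define q where "q = \<alpha>' / \<alpha>"
  have q: "0 < q" "q < 1" using \<alpha>' by (auto simp: q_def)
  let ?\<theta> = "\<alpha> + \<beta> - 1"
  have "0 \<le> \<rho>" using \<rho> norm_ge_zero order_trans by blast
  have "0 \<le> N" "0 \<le> G"
    using apriori_holder_nonneg[OF \<open>0 \<le> \<rho>\<close>] grid_error_const_nonneg[OF \<open>0 \<le> \<rho>\<close>]
    by (auto simp: N_def G_def)
  have E: "E = 2 * N + G" by (simp add: E_def sup_error_const_def N_def G_def)
  have "0 < n" using range T_pos by (cases n) auto
  note le = increasing_upto_le[of n t, OF incr]
  have y_holder: "norm (y l - y k) \<le> N * (t l - t k) powr \<alpha>" if "k \<le> l" "l \<le> n" for k l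
    unfolding N_def
  proof (rule euler_apriori(2)[of n t y])
    fix k assume "k < n"
    then show "t (Suc k) - t k \<le> step_size A R \<alpha> \<beta> / 2"
      using fine(1)[of k] fine(2) by (simp add: euler_step_def)
  qed (use incr range y \<rho> that in auto)
  have f_holder: "holder_bounded T \<alpha> (3 * N) f"
    using exps \<open>0 \<le> N\<close> \<open>0 < n\<close> incr range y_holder f
    by (intro piecewise_linear_holder[of n t T y]) auto
  have x_holder: "holder_bounded T \<alpha> N x"
    unfolding N_def using x \<rho> by (rule solution_holder)
  have diff_holder: "holder_bounded T \<alpha> (4 * N) (\<lambda>r. f r - x r)"
    unfolding holder_bounded_def
  proof (intro allI impI, elim conjE)
    fix r s assume "0 \<le> s" "s \<le> r" "r \<le> T"
    then have "norm (f r - f s) \<le> 3 * N * (r - s) powr \<alpha>" "norm (x r - x s) \<le> N * (r - s) powr \<alpha>"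
      using holder_boundedD[OF f_holder] holder_boundedD[OF x_holder] by auto
    moreover have "norm ((f r - x r) - (f s - x s)) \<le> norm (f r - f s) + norm (x r - x s)"
      using norm_triangle_ineq4[of "f r - f s" "x r - x s"] by (simp add: algebra_simps)
    ultimately show "norm ((f r - x r) - (f s - x s)) \<le> 4 * N * (r - s) powr \<alpha>" by simp
  qed
  have \<delta>_powr: "\<delta> powr \<alpha> \<le> \<delta> powr ?\<theta>"
    using fine(3,4) exps by (intro powr_mono') auto
  have sup: "norm (f r - x r) \<le> E * \<delta> powr ?\<theta>" if "r \<in> {0..T}" for r
  proof -
    obtain k where k: "k < n" "t k \<le> r" "r \<le> t (Suc k)"
      by (rule exists_grid_cell[of n t r]) (use \<open>0 < n\<close> range \<open>r \<in> {0..T}\<close> in auto)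
    have tk: "0 \<le> t k" "r - t k \<le> \<delta>" using le[of 0 k] k range fine(1)[of k] by auto
    have f_tk: "f (t k) = y k" using f[of k "t k"] k incr[of k] by simp
    have close: "L * (r - t k) powr \<alpha> \<le> L * \<delta> powr ?\<theta>" if "0 \<le> L" for L
    proof -
      have "(r - t k) powr \<alpha> \<le> \<delta> powr \<alpha>" using tk k exps by (intro powr_mono2) auto
      then show ?thesis using \<delta>_powr that by (intro mult_left_mono) auto
    qed
    have 1: "norm (f r - f (t k)) \<le> N * \<delta> powr ?\<theta>"
    proof -
      define c where "c = (r - t k) / (t (Suc k) - t k)"
      have c: "0 \<le> c" "c \<le> 1" using k incr[of k] by (auto simp: c_def)
      have "f r - f (t k) = c *\<^sub>R (y (Suc k) - y k)"
        using f[OF k] f_tk by (simp add: c_def)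
      then have "norm (f r - f (t k)) = c * norm (y (Suc k) - y k)"
        using c by simp
      also have "\<dots> \<le> norm (y (Suc k) - y k)"
        using c by (simp add: mult_left_le_one_le)
      also have "\<dots> \<le> N * (t (Suc k) - t k) powr \<alpha>"
        using y_holder[of k "Suc k"] k by simp
      also have "\<dots> \<le> N * \<delta> powr \<alpha>"
        using fine(1)[of k] k incr[of k] exps \<open>0 \<le> N\<close> by (intro mult_left_mono powr_mono2) auto
      also have "\<dots> \<le> N * \<delta> powr ?\<theta>" using \<delta>_powr \<open>0 \<le> N\<close> by (rule mult_left_mono)
      finally show ?thesis .
    qed
    have 2: "norm (x (t k) - y k) \<le> G * \<delta> powr ?\<theta>"
      unfolding G_def using k by (intro euler_grid_error[OF x \<rho> incr range fine(1-3) y]) auto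
    have 3: "norm (x r - x (t k)) \<le> N * \<delta> powr ?\<theta>"
      using order_trans[OF holder_boundedD[OF x_holder, of "t k" r] close[of N]] tk k \<open>0 \<le> N\<close> that by simp
    have "f r - x r = (f r - f (t k)) - (x (t k) - y k) - (x r - x (t k))"
      by (simp add: f_tk)
    then have "norm (f r - x r)
        \<le> norm (f r - f (t k)) + norm (x (t k) - y k) + norm (x r - x (t k))"
      by (smt (verit) norm_triangle_ineq4)
    then show ?thesis using 1 2 3 by (simp add: E algebra_simps)
  qed
  have "0 \<le> E" using \<open>0 \<le> N\<close> \<open>0 \<le> G\<close> by (simp add: E)
  have "holder_bounded T \<alpha>' ((4 * N) powr q * (2 * (E * \<delta> powr ?\<theta>)) powr (1 - q)) (\<lambda>r. f r - x r)"
    unfolding q_def using diff_holder sup \<alpha>' \<open>0 \<le> N\<close> by (intro holder_interpolation) auto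
  then have "holder_norm T \<alpha>' (\<lambda>r. f r - x r)
      \<le> ennreal (E * \<delta> powr ?\<theta> + (4 * N) powr q * (2 * (E * \<delta> powr ?\<theta>)) powr (1 - q))"
    using sup \<open>0 \<le> E\<close> by (intro holder_norm_le) auto
  also have "\<dots> \<le> ennreal (euler_const T A R \<alpha> \<beta> \<rho> * \<delta> powr ((1 - q) * ?\<theta>))"
  proof (rule ennreal_leI)
    \<comment> \<open>This makes the constant independent of \<open>q\<close>, hence of \<open>\<alpha>'\<close>.\<close>
    have base: "u powr p \<le> u + 1" if "0 \<le> u" "0 \<le> p" "p \<le> 1" for u p :: real
    proof -
      have "u powr p \<le> (u + 1) powr p" using that by (intro powr_mono2) auto
      also have "\<dots> \<le> (u + 1) powr 1" using that by (intro powr_mono) auto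
      finally show ?thesis using that by simp
    qed
    have "(1 - q) * ?\<theta> \<le> ?\<theta>" using q exps by (simp add: mult_left_le_one_le)
    then have 1: "E * \<delta> powr ?\<theta> \<le> E * \<delta> powr ((1 - q) * ?\<theta>)"
      using \<open>0 \<le> E\<close> fine(3,4) q exps by (intro mult_left_mono powr_mono') auto
    have "(2 * (E * \<delta> powr ?\<theta>)) powr (1 - q) = (2 * E) powr (1 - q) * \<delta> powr ((1 - q) * ?\<theta>)"
      using powr_mult[of "2 * E" "\<delta> powr ?\<theta>" "1 - q"] \<open>0 \<le> E\<close> by (simp add: powr_powr mult_ac)
    then have "(4 * N) powr q * (2 * (E * \<delta> powr ?\<theta>)) powr (1 - q)
        = (4 * N) powr q * (2 * E) powr (1 - q) * \<delta> powr ((1 - q) * ?\<theta>)" by simp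
    also have "\<dots> \<le> (4 * N + 1) * (2 * E + 1) * \<delta> powr ((1 - q) * ?\<theta>)"
      using \<open>0 \<le> N\<close> \<open>0 \<le> E\<close> q by (intro mult_right_mono mult_mono base) auto
    finally have "E * \<delta> powr ?\<theta> + (4 * N) powr q * (2 * (E * \<delta> powr ?\<theta>)) powr (1 - q)
        \<le> E * \<delta> powr ((1 - q) * ?\<theta>) + (4 * N + 1) * (2 * E + 1) * \<delta> powr ((1 - q) * ?\<theta>)"
      using 1 by (rule add_mono[rotated])
    then show "E * \<delta> powr ?\<theta> + (4 * N) powr q * (2 * (E * \<delta> powr ?\<theta>)) powr (1 - q)
        \<le> euler_const T A R \<alpha> \<beta> \<rho> * \<delta> powr ((1 - q) * ?\<theta>)"
      by (simp add: euler_const_def E_def N_def distrib_right)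
  qed
  finally show ?thesis by (simp add: q_def)
qed

end

lemma growth_lipschitz_mono:
  assumes "growth_lipschitz T \<alpha> A F" "A \<le> A'"
  shows "growth_lipschitz T \<alpha> A' F"
  unfolding growth_lipschitz_def
proof (intro ballI allI)
  fix s t p q assume "s \<in> {0..T}" "t \<in> {0..T}"
  then have "norm (F t p - F s q) \<le> A * (norm (p - q) + (1 + norm p + norm q) * \<bar>t - s\<bar> powr \<alpha>)"
    using assms(1) by (simp add: growth_lipschitz_def)
  also have "\<dots> \<le> A' * (norm (p - q) + (1 + norm p + norm q) * \<bar>t - s\<bar> powr \<alpha>)"
    using assms(2) by (intro mult_right_mono) auto
  finally show "norm (F t p - F s q)
      \<le> A' * (norm (p - q) + (1 + norm p + norm q) * \<bar>t - s\<bar> powr \<alpha>)" .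
qed

text \<open>
  One constant \<open>A\<close> serves all paths of norm at most \<open>R\<close>: the continuous functions in the definition of
  niceness are only evaluated on compact sets that depend on \<open>T\<close> and \<open>R\<close>.
\<close>

lemma nice_function_along_paths:
  fixes \<sigma> :: "real \<Rightarrow> 'w::banach \<Rightarrow> 'x::banach \<Rightarrow> 'v::banach \<Rightarrow>\<^sub>L 'x"
  assumes "nice_function \<alpha> \<sigma>" "0 \<le> R"
  obtains A and D :: "real \<Rightarrow> 'w \<Rightarrow> 'x \<Rightarrow> 'x \<Rightarrow>\<^sub>L ('v \<Rightarrow>\<^sub>L 'x)" where
    "\<And>t w x. norm (\<sigma> t w x) \<le> A"
    "\<And>t w x. (\<sigma> t w has_derivative D t w x) (at x)"
    "\<And>w. holder_norm T \<alpha> w \<le> ennreal R \<Longrightarrow> growth_lipschitz T \<alpha> A (\<lambda>t. \<sigma> t (w t))"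
    "\<And>w. holder_norm T \<alpha> w \<le> ennreal R \<Longrightarrow> growth_lipschitz T \<alpha> A (\<lambda>t. D t (w t))"
proof -
  obtain M where M: "\<And>t w x. norm (\<sigma> t w x) \<le> M"
    using assms unfolding nice_function_def by blast
  obtain D :: "real \<Rightarrow> 'w \<Rightarrow> 'x \<Rightarrow> 'x \<Rightarrow>\<^sub>L ('v \<Rightarrow>\<^sub>L 'x)" and c c' where
    D: "\<And>t w x. (\<sigma> t w has_derivative D t w x) (at x)"
    and c: "continuous_on UNIV c" "locally_lipschitz_growth c \<sigma>" "locally_lipschitz_growth c D"
    and c': "continuous_on UNIV c'" "time_holder_growth \<alpha> c' \<sigma>" "time_holder_growth \<alpha> c' D"
    using assms unfolding nice_function_def by blast
  have "compact ({0..T} \<times> {0..R} \<times> {0..R})" by (intro compact_Times compact_Icc)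
  then obtain K1 where K1: "\<And>z. z \<in> {0..T} \<times> {0..R} \<times> {0..R} \<Longrightarrow> c z \<le> K1"
    by (rule exists_bound_on_compact[OF c(1)]) (rule that)
  obtain K2 where K2: "\<And>z. z \<in> {0..R} \<Longrightarrow> c' z \<le> K2"
    by (rule exists_bound_on_compact[OF c'(1) compact_Icc]) (rule that)
  define K A where "K = max 0 (max K1 K2)" and "A = max M (K * (R + 1))"
  have K: "0 \<le> K" "K1 \<le> K" "K2 \<le> K" by (auto simp: K_def)
  have c_le: "c (t, r, r') \<le> K" if "t \<in> {0..T}" "r \<in> {0..R}" "r' \<in> {0..R}" for t r r'
    using K1[of "(t, r, r')"] that K(2) by simp
  have c'_le: "c' r \<le> K" if "r \<in> {0..R}" for r
    using K2[OF that] K(3) by simp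
  show thesis
  proof (rule that)
    show "norm (\<sigma> t w x) \<le> A" for t w x using M[of t w x] by (simp add: A_def)
    show "(\<sigma> t w has_derivative D t w x) (at x)" for t w x by (rule D)
    fix w :: "real \<Rightarrow> 'w" assume w: "holder_norm T \<alpha> w \<le> ennreal R"
    show "growth_lipschitz T \<alpha> A (\<lambda>t. \<sigma> t (w t))"
      by (rule growth_lipschitz_mono[OF growth_lipschitz_along_path[OF c(2) c'(2) c_le c'_le w assms(2) K(1)]])
         (simp_all add: A_def)
    show "growth_lipschitz T \<alpha> A (\<lambda>t. D t (w t))"
      by (rule growth_lipschitz_mono[OF growth_lipschitz_along_path[OF c(3) c'(3) c_le c'_le w assms(2) K(1)]])
         (simp_all add: A_def)
  qed
qed

text \<open>
  The constants are functions of \<open>T\<close>, \<open>A\<close>, \<open>R\<close>, \<open>\<alpha>\<close>, \<open>\<beta>\<close>, and \<open>A\<close> depends only on \<open>\<sigma>\<close>, \<open>T\<close>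
  and \<open>R\<close>, so they can be chosen before the data \<open>a\<close>, \<open>g\<close>, \<open>w\<close>.
\<close>

lemma euler_rate:
  fixes T \<alpha> \<beta> R :: real
    and \<sigma> :: "real \<Rightarrow> 'w::banach \<Rightarrow> 'x::banach \<Rightarrow> 'v::banach \<Rightarrow>\<^sub>L 'x"
  assumes "0 < T" and "1 / 2 < \<alpha>" "\<alpha> < \<beta>" "\<beta> \<le> 1" and \<sigma>: "nice_function \<alpha> \<sigma>" and "0 < R"
  obtains C \<tau> where "0 < C" "0 < \<tau>"
    "\<And>\<alpha>' a g w x \<pi>. 0 < \<alpha>' \<Longrightarrow> \<alpha>' < \<alpha> \<Longrightarrow> norm a \<le> R \<Longrightarrow>
      holder_seminorm T \<beta> g \<le> ennreal R \<Longrightarrow> holder_norm T \<alpha> w \<le> ennreal R \<Longrightarrow>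
      young_solution T \<alpha> \<sigma> w g a x \<Longrightarrow> is_partition 0 T \<pi> \<Longrightarrow> mesh \<pi> \<le> \<tau> \<Longrightarrow>
      holder_norm T \<alpha>' (\<lambda>t. euler_interp \<sigma> w g a \<pi> t - x t)
        \<le> ennreal (C * mesh \<pi> powr ((1 - \<alpha>' / \<alpha>) * (\<alpha> + \<beta> - 1)))"
proof -
  obtain A and D :: "real \<Rightarrow> 'w \<Rightarrow> 'x \<Rightarrow> 'x \<Rightarrow>\<^sub>L ('v \<Rightarrow>\<^sub>L 'x)" where
    A: "\<And>t w x. norm (\<sigma> t w x) \<le> A"
    "\<And>t w x. (\<sigma> t w has_derivative D t w x) (at x)"
    "\<And>w. holder_norm T \<alpha> w \<le> ennreal R \<Longrightarrow> growth_lipschitz T \<alpha> A (\<lambda>t. \<sigma> t (w t))"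
    "\<And>w. holder_norm T \<alpha> w \<le> ennreal R \<Longrightarrow> growth_lipschitz T \<alpha> A (\<lambda>t. D t (w t))"
    by (rule nice_function_along_paths[OF \<sigma> less_imp_le[OF \<open>0 < R\<close>], of T]) (rule that)
  have eqn: "young_equation T \<alpha> \<beta> A R (\<lambda>t. \<sigma> t (w t)) (\<lambda>t. D t (w t)) g"
    if "holder_seminorm T \<beta> g \<le> ennreal R" "holder_norm T \<alpha> w \<le> ennreal R" for g w
  proof
    show "0 \<le> A" using order_trans[OF norm_ge_zero A(1)] .
    show "holder_bounded T \<beta> R g" using that(1) \<open>0 < R\<close> by (simp add: holder_seminorm_le_iff)
  qed (use assms A that in auto)
  define C \<tau> where "C = euler_const T A R \<alpha> \<beta> R" and "\<tau> = min 1 (euler_step T A R \<alpha> \<beta> R)"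
  have zero: "holder_seminorm T \<beta> (\<lambda>_. 0 :: 'v) \<le> ennreal R" "holder_norm T \<alpha> (\<lambda>_. 0 :: 'w) \<le> ennreal R"
    using holder_norm_le[of T \<alpha> 0 "\<lambda>_. 0 :: 'w" 0] \<open>0 < R\<close>
    by (auto simp: holder_seminorm_le_iff holder_bounded_def)
  \<comment> \<open>Positivity of the constants is read off from the instance with zero data.\<close>
  interpret zero: young_equation T \<alpha> \<beta> A R "\<lambda>t. \<sigma> t 0" "\<lambda>t. D t 0" "\<lambda>_. 0"
    using eqn[OF zero] .
  show thesis
  proof (rule that)
    show "0 < C" "0 < \<tau>"
      using zero.euler_const_pos zero.euler_step_pos \<open>0 < R\<close> by (auto simp: C_def \<tau>_def)
  next
    fix \<alpha>' :: real and a :: 'x and g :: "real \<Rightarrow> 'v" and w :: "real \<Rightarrow> 'w" and x \<pi>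
    assume \<alpha>': "0 < \<alpha>'" "\<alpha>' < \<alpha>" and a: "norm a \<le> R"
      and g: "holder_seminorm T \<beta> g \<le> ennreal R" and w: "holder_norm T \<alpha> w \<le> ennreal R"
      and x: "young_solution T \<alpha> \<sigma> w g a x" and \<pi>: "is_partition 0 T \<pi>" and mesh: "mesh \<pi> \<le> \<tau>"
    interpret young_equation T \<alpha> \<beta> A R "\<lambda>t. \<sigma> t (w t)" "\<lambda>t. D t (w t)" g
      using eqn[OF g w] .
    have "\<pi> \<noteq> []" using \<pi> by (simp add: is_partition_def)
    have step: "\<pi> ! k < \<pi> ! Suc k" if "k < length \<pi> - 1" for k
      using \<pi> that by (auto simp: is_partition_def sorted_wrt_iff_nth_less)
    have mesh_step: "\<pi> ! Suc k - \<pi> ! k \<le> mesh \<pi>" if "k < length \<pi> - 1" for k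
      using mesh_le_iff[OF mesh_nonneg, of \<pi> \<pi>] that by fastforce
    have ends: "\<pi> ! 0 = 0" "\<pi> ! (length \<pi> - 1) = T"
      using \<pi> hd_conv_nth[of \<pi>] last_conv_nth[of \<pi>] by (auto simp: is_partition_def)
    show "holder_norm T \<alpha>' (\<lambda>t. euler_interp \<sigma> w g a \<pi> t - x t)
        \<le> ennreal (C * mesh \<pi> powr ((1 - \<alpha>' / \<alpha>) * (\<alpha> + \<beta> - 1)))"
      unfolding C_def
    proof (rule interpolated_euler_error[where n = "length \<pi> - 1" and t = "\<lambda>k. \<pi> ! k"
          and y = "euler \<sigma> w g a \<pi>" and a = a])
      show "solution a x" using x by (simp add: solution_def young_solution_def)
    next
      fix k r assume "k < length \<pi> - 1" "\<pi> ! k \<le> r" "r \<le> \<pi> ! Suc k"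
      then show "euler_interp \<sigma> w g a \<pi> r = euler \<sigma> w g a \<pi> k
          + ((r - \<pi> ! k) / (\<pi> ! Suc k - \<pi> ! k)) *\<^sub>R (euler \<sigma> w g a \<pi> (Suc k) - euler \<sigma> w g a \<pi> k)"
        by (intro euler_interp_cell[OF \<pi>]) auto
    qed (use a \<alpha>' step mesh_step ends mesh mesh_nonneg[of \<pi>] in \<open>auto simp: \<tau>_def\<close>)
  qed
qed

theorem theorem4p8:
  fixes T \<alpha> \<beta> :: real
    and \<sigma> :: "real \<Rightarrow> 'w::banach \<Rightarrow> 'x::banach \<Rightarrow> 'v::banach \<Rightarrow>\<^sub>L 'x"
  assumes "T > 0"
    and "1/2 < \<beta>" and "\<beta> \<le> 1"
    and "1/2 < \<alpha>" and "\<alpha> < \<beta>"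
    and "nice_function \<alpha> \<sigma>"
  shows
    "(\<forall>(g :: real \<Rightarrow> 'v) \<in> holder_space T \<beta>. \<forall>(w :: real \<Rightarrow> 'w) \<in> holder_space T \<alpha>. \<forall>(a :: 'x) x \<alpha>'.
        young_solution T \<alpha> \<sigma> w g a x \<and> 0 < \<alpha>' \<and> \<alpha>' < \<alpha> \<longrightarrow>
        ((\<lambda>\<pi>. holder_norm T \<alpha>' (\<lambda>t. euler_interp \<sigma> w g a \<pi> t - x t)) \<longlongrightarrow> 0) (mesh_to_zero 0 T))
     \<and>
     (\<forall>R>0. \<exists>C>0. \<exists>\<tau>>0. \<forall>\<alpha>' (a :: 'x) (g :: real \<Rightarrow> 'v) (w :: real \<Rightarrow> 'w) x \<pi>.
        0 < \<alpha>' \<and> \<alpha>' < \<alpha> \<and>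
        norm a \<le> R \<and>
        g \<in> holder_space T \<beta> \<and> holder_seminorm T \<beta> g \<le> ennreal R \<and>
        w \<in> holder_space T \<alpha> \<and> holder_norm T \<alpha> w \<le> ennreal R \<and>
        young_solution T \<alpha> \<sigma> w g a x \<and>
        is_partition 0 T \<pi> \<and> mesh \<pi> \<le> \<tau> \<longrightarrow>
        holder_norm T \<alpha>' (\<lambda>t. euler_interp \<sigma> w g a \<pi> t - x t)
          \<le> ennreal (C * mesh \<pi> powr ((1 - \<alpha>' / \<alpha>) * (\<alpha> + \<beta> - 1))))"
proof (rule conjI, intro ballI allI impI, elim conjE)
  fix g :: "real \<Rightarrow> 'v" and w :: "real \<Rightarrow> 'w" and a x and \<alpha>' :: real
  assume g: "g \<in> holder_space T \<beta>" and w: "w \<in> holder_space T \<alpha>"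
    and x: "young_solution T \<alpha> \<sigma> w g a x" and \<alpha>': "0 < \<alpha>'" "\<alpha>' < \<alpha>"
  obtain R1 where R1: "0 \<le> R1" "holder_norm T \<beta> g \<le> ennreal R1" using g by (rule holder_spaceE)
  obtain R2 where R2: "0 \<le> R2" "holder_norm T \<alpha> w \<le> ennreal R2" using w by (rule holder_spaceE)
  define R where "R = norm a + R1 + R2 + 1"
  have "0 < R" "R1 \<le> R" "R2 \<le> R" "norm a \<le> R"
    using R1(1) R2(1) by (auto simp: R_def add_nonneg_pos)
  have "holder_seminorm T \<beta> g \<le> holder_norm T \<beta> g" by (simp add: holder_norm_def)
  then have g_le: "holder_seminorm T \<beta> g \<le> ennreal R"
    using R1(2) ennreal_leI[OF \<open>R1 \<le> R\<close>] by (meson order_trans)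
  have w_le: "holder_norm T \<alpha> w \<le> ennreal R"
    using R2(2) ennreal_leI[OF \<open>R2 \<le> R\<close>] by (rule order_trans)
  obtain C \<tau> where "0 < \<tau>" and rate: "\<And>\<pi>. is_partition 0 T \<pi> \<Longrightarrow> mesh \<pi> \<le> \<tau> \<Longrightarrow>
      holder_norm T \<alpha>' (\<lambda>t. euler_interp \<sigma> w g a \<pi> t - x t)
        \<le> ennreal (C * mesh \<pi> powr ((1 - \<alpha>' / \<alpha>) * (\<alpha> + \<beta> - 1)))"
    by (rule euler_rate[OF assms(1,4,5,3,6) \<open>0 < R\<close>])
       (use \<alpha>' \<open>norm a \<le> R\<close> g_le w_le x in blast)
  have "0 < (1 - \<alpha>' / \<alpha>) * (\<alpha> + \<beta> - 1)" using \<alpha>' assms by simp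
  then have "((\<lambda>\<pi>. mesh \<pi> powr ((1 - \<alpha>' / \<alpha>) * (\<alpha> + \<beta> - 1))) \<longlongrightarrow> 0) (mesh_to_zero 0 T)"
    by (intro tendsto_zero_powrI[OF filterlim_mesh tendsto_const] always_eventually) (auto simp: mesh_nonneg)
  then have "((\<lambda>\<pi>. ennreal (C * mesh \<pi> powr ((1 - \<alpha>' / \<alpha>) * (\<alpha> + \<beta> - 1)))) \<longlongrightarrow> ennreal (C * 0))
      (mesh_to_zero 0 T)"
    by (intro tendsto_ennrealI tendsto_mult_left)
  then have upper: "((\<lambda>\<pi>. ennreal (C * mesh \<pi> powr ((1 - \<alpha>' / \<alpha>) * (\<alpha> + \<beta> - 1)))) \<longlongrightarrow> 0)
      (mesh_to_zero 0 T)" by simp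
  show "((\<lambda>\<pi>. holder_norm T \<alpha>' (\<lambda>t. euler_interp \<sigma> w g a \<pi> t - x t)) \<longlongrightarrow> 0) (mesh_to_zero 0 T)"
  proof (rule tendsto_sandwich[OF _ _ tendsto_const upper])
    show "\<forall>\<^sub>F \<pi> in mesh_to_zero 0 T. holder_norm T \<alpha>' (\<lambda>t. euler_interp \<sigma> w g a \<pi> t - x t)
        \<le> ennreal (C * mesh \<pi> powr ((1 - \<alpha>' / \<alpha>) * (\<alpha> + \<beta> - 1)))"
      unfolding eventually_mesh_to_zero using \<open>0 < \<tau>\<close> rate less_imp_le by blast
  qed simp
next
  show "\<forall>R>0. \<exists>C>0. \<exists>\<tau>>0. \<forall>\<alpha>' (a :: 'x) (g :: real \<Rightarrow> 'v) (w :: real \<Rightarrow> 'w) x \<pi>.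
        0 < \<alpha>' \<and> \<alpha>' < \<alpha> \<and>
        norm a \<le> R \<and>
        g \<in> holder_space T \<beta> \<and> holder_seminorm T \<beta> g \<le> ennreal R \<and>
        w \<in> holder_space T \<alpha> \<and> holder_norm T \<alpha> w \<le> ennreal R \<and>
        young_solution T \<alpha> \<sigma> w g a x \<and>
        is_partition 0 T \<pi> \<and> mesh \<pi> \<le> \<tau> \<longrightarrow>
        holder_norm T \<alpha>' (\<lambda>t. euler_interp \<sigma> w g a \<pi> t - x t)
          \<le> ennreal (C * mesh \<pi> powr ((1 - \<alpha>' / \<alpha>) * (\<alpha> + \<beta> - 1)))"
  proof (intro allI impI)
    fix R :: real assume "0 < R"
    show "\<exists>C>0. \<exists>\<tau>>0. \<forall>\<alpha>' (a :: 'x) (g :: real \<Rightarrow> 'v) (w :: real \<Rightarrow> 'w) x \<pi>.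
        0 < \<alpha>' \<and> \<alpha>' < \<alpha> \<and>
        norm a \<le> R \<and>
        g \<in> holder_space T \<beta> \<and> holder_seminorm T \<beta> g \<le> ennreal R \<and>
        w \<in> holder_space T \<alpha> \<and> holder_norm T \<alpha> w \<le> ennreal R \<and>
        young_solution T \<alpha> \<sigma> w g a x \<and>
        is_partition 0 T \<pi> \<and> mesh \<pi> \<le> \<tau> \<longrightarrow>
        holder_norm T \<alpha>' (\<lambda>t. euler_interp \<sigma> w g a \<pi> t - x t)
          \<le> ennreal (C * mesh \<pi> powr ((1 - \<alpha>' / \<alpha>) * (\<alpha> + \<beta> - 1)))"
      by (rule euler_rate[OF assms(1,4,5,3,6) \<open>0 < R\<close>]) blast
  qed
qed

end
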